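(* Let $K$ and $L$ be compact lines and $\phi:K\to L$ a continuous increasing surjection. If $L$ is separably determined and $\phi^{-1}(t)$ is separably determined for every $t\in L$, then $K$ is separably determined.
   Context: A compact line is a totally ordered set which is compact in its order topology; each $\phi^{-1}(t)$ is a closed interval of $K$, hence a compact line. For a compact line $H$, $H^+$ is the set of right-isolated points of $H$ ($\max H$ or points with an immediate successor in $H$). $\mathrm{NBV}(K)$ is the space of right-continuous real maps of bounded variation on $K$, identified with $C(K)^*$ via $F_\mu(t)=\mu([\min K,t])$. $\lim_{i\in I}a_i=0$ means $\{i:|a_i|\ge\varepsilon\}$ is finite for every $\varepsilon>0$; $c_0(I)$ is the set of such families. $(F_i)_{i\in I}$ is weak*-null if $\lim_i\int f\,d\mu_i=0$ for all $f\in C(K)$, $\mu_i$ associated with $F_i$. $(F_i)$ is of type $c_0\ell_1$ over $Q$ if $F_i(t)=a_{i,t}+b_{i,t}$ ($i\in I,t\in Q$) with $\lim_ia_{i,t}=0$ for each $t$ and $\sup_i\sum_{t\in Q}|b_{i,t}|<\infty$. A compact line $K$ is separably determined if for every weak*-null family $(F_i)_{i\in I}$ in $\mathrm{NBV}(K)$ and every $Q\subseteq K$: whenever $\{t\in Q\cap(H\setminus H^+):(F_i(t))_{i\in I}\notin c_0(I)\}$ is countable for every closed separable $H\subseteq K$, the family is of type $c_0\ell_1$ over $Q$. *)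

theory Defs
  imports "HOL-Analysis.Analysis" "HOL-Probability.Probability"
begin

definition order_top :: "'a::linorder set \<Rightarrow> 'a topology" where
  "order_top S = topology_generated_by
     (insert S ((\<lambda>a. {x\<in>S. x < a}) ` S \<union> (\<lambda>a. {x\<in>S. a < x}) ` S))"

definition compact_line :: "'a::linorder set \<Rightarrow> bool" where
  "compact_line K \<longleftrightarrow> K \<noteq> {} \<and> compactin (order_top K) K"

definition right_isolated :: "'a::linorder set \<Rightarrow> 'a set" where
  "right_isolated H = {x\<in>H. (\<forall>y\<in>H. y \<le> x) \<or>
                          (\<exists>y\<in>H. x < y \<and> \<not> (\<exists>z\<in>H. x < z \<and> z < y))}"

definition right_continuous_on :: "'a::linorder set \<Rightarrow> ('a \<Rightarrow> real) \<Rightarrow> bool" where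
  "right_continuous_on K F \<longleftrightarrow>
     (\<forall>t\<in>K. (\<exists>y\<in>K. t < y) \<longrightarrow>
        (\<forall>\<epsilon>>0. \<exists>u\<in>K. t < u \<and> (\<forall>s\<in>K. t \<le> s \<and> s < u \<longrightarrow> \<bar>F s - F t\<bar> < \<epsilon>)))"

definition bounded_variation_on :: "'a::linorder set \<Rightarrow> ('a \<Rightarrow> real) \<Rightarrow> bool" where
  "bounded_variation_on K F \<longleftrightarrow>
     (\<exists>C. \<forall>ts. sorted_wrt (<) ts \<and> set ts \<subseteq> K \<longrightarrow>
        (\<Sum>k<length ts - 1. \<bar>F (ts ! Suc k) - F (ts ! k)\<bar>) \<le> C)"

definition NBV :: "'a::linorder set \<Rightarrow> ('a \<Rightarrow> real) set" where
  "NBV K = {F. right_continuous_on K F \<and> bounded_variation_on K F}"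

definition order_borel :: "'a::linorder set \<Rightarrow> 'a measure" where
  "order_borel K = sigma K {U. openin (order_top K) U}"

definition radon_on :: "'a::linorder set \<Rightarrow> 'a measure \<Rightarrow> bool" where
  "radon_on K M \<longleftrightarrow> sets M = sets (order_borel K) \<and> finite_measure M \<and>
     (\<forall>A\<in>sets M. emeasure M A = (SUP C\<in>{C. compactin (order_top K) C \<and> C \<subseteq> A}. emeasure M C))"

text \<open>A finite signed Radon measure \<mu> = M1 - M2 is associated with F when
  F t = \<mu>([min K, t]) for t in K.\<close>
definition associated :: "'a::linorder set \<Rightarrow> ('a \<Rightarrow> real) \<Rightarrow> 'a measure \<Rightarrow> 'a measure \<Rightarrow> bool" where
  "associated K F M1 M2 \<longleftrightarrow> radon_on K M1 \<and> radon_on K M2 \<and>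
     (\<forall>t\<in>K. F t = measure M1 {s\<in>K. s \<le> t} - measure M2 {s\<in>K. s \<le> t})"

definition c0_lim :: "'i set \<Rightarrow> ('i \<Rightarrow> real) \<Rightarrow> bool" where
  "c0_lim I a \<longleftrightarrow> (\<forall>\<epsilon>>0. finite {i\<in>I. \<bar>a i\<bar> \<ge> \<epsilon>})"

definition weak_star_null :: "'a::linorder set \<Rightarrow> 'i set \<Rightarrow> ('i \<Rightarrow> 'a \<Rightarrow> real) \<Rightarrow> bool" where
  "weak_star_null K I F \<longleftrightarrow>
     (\<exists>M1 M2. (\<forall>i\<in>I. associated K (F i) (M1 i) (M2 i)) \<and>
        (\<forall>f. continuous_map (order_top K) euclideanreal f \<longrightarrow>
             c0_lim I (\<lambda>i. integral\<^sup>L (M1 i) f - integral\<^sup>L (M2 i) f)))"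

definition type_c0l1 :: "'i set \<Rightarrow> ('i \<Rightarrow> 'a \<Rightarrow> real) \<Rightarrow> 'a set \<Rightarrow> bool" where
  "type_c0l1 I F Q \<longleftrightarrow>
     (\<exists>a b. (\<forall>i\<in>I. \<forall>t\<in>Q. F i t = a i t + b i t) \<and>
            (\<forall>t\<in>Q. c0_lim I (\<lambda>i. a i t)) \<and>
            (\<exists>C. \<forall>i\<in>I. (\<lambda>t. \<bar>b i t\<bar>) summable_on Q \<and> (\<Sum>\<^sub>\<infinity>t\<in>Q. \<bar>b i t\<bar>) \<le> C))"

definition separably_determined :: "'i itself \<Rightarrow> 'a::linorder set \<Rightarrow> bool" where
  "separably_determined _ K \<longleftrightarrow>
     (\<forall>(I::'i set) F Q. (\<forall>i\<in>I. F i \<in> NBV K) \<and> weak_star_null K I F \<and> Q \<subseteq> K \<and>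
        (\<forall>H. closedin (order_top K) H \<and> separable_space (subtopology (order_top K) H) \<longrightarrow>
             countable {t \<in> Q \<inter> (H - right_isolated H). \<not> c0_lim I (\<lambda>i. F i t)})
        \<longrightarrow> type_c0l1 I F Q)"

end

theory Submission
  imports Defs
begin

text \<open>
  A weak*-null family is of type \<open>c\<^sub>0\<ell>\<^sub>1\<close> over \<open>Q\<close> as soon as there are countable sets \<open>P i\<close> such that,
  for each \<open>s \<in> Q\<close>, the values \<open>F i s\<close> over those \<open>i\<close> with \<open>s \<notin> P i\<close> tend to \<open>0\<close>. The constant in the
  \<open>\<ell>\<^sub>1\<close> bound then depends only on the norms of the measures, so the fibres may contribute with
  unrelated constants.

  The push-forward along \<open>\<phi>\<close> takes at \<open>t\<close> the value of \<open>F i\<close> at the maximum of the fibre over \<open>t\<close>, so \<open>L\<close>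
  yields such sets for the fibre maxima. The push-forward along the retraction of \<open>K\<close> onto a fibre
  agrees with \<open>F i\<close> below the maximum of that fibre, which settles the other points of that
  fibre. For a given \<open>i\<close> only the countably many fibres charged by the measure are needed: below the
  maximum \<open>u\<close> of an uncharged fibre, \<open>F i s\<close> equals \<open>\<integral> g d\<mu>\<^sub>i\<close> for a fixed Urysohn function \<open>g\<close>
  descending from \<open>1\<close> to \<open>0\<close> between \<open>s\<close> and \<open>u\<close>.
\<close>

section \<open>Order topologies\<close>

text \<open>Of each given decomposition only the supports of the \<open>b\<close> parts are kept:
  countable unions of them stay countable, whereas the sums over them cannot be controlled jointly.
  A bound is recovered from the measures. For a finite set \<open>S\<close>, Urysohn functions
  descending between consecutive points of \<open>S\<close> have integrals tending to 0, and what
  separates these integrals from the values \<open>F i s\<close> lives in disjoint gaps. So for all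
  but finitely many \<open>i\<close> the sum of \<open>\<bar>F i s\<bar>\<close> over
  \<open>S\<close> stays below a constant independent of \<open>S\<close>. The finite set of
  exceptional indices does depend on \<open>S\<close>, so each point can afford only one finite set.
  This forces an enumeration of points shared by all \<open>i\<close>, hence countable components,
  hence the fact that only countably many \<open>F i\<close> are nonzero at a given point. The pair
  \<open>M i\<close>, \<open>N i\<close> is an arbitrary representation of the signed measure, and
  its total masses may be unbounded in \<open>i\<close>. Norm bounds therefore come from uniform
  boundedness of the functionals on continuous functions.\<close>

lemma topspace_order_top [simp]: "topspace (order_top K) = K"
  unfolding order_top_def by auto

lemma openin_order_top_less: "a \<in> K \<Longrightarrow> openin (order_top K) {x\<in>K. x < a}"
  unfolding order_top_def by (rule topology_generated_by_Basis) auto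

lemma openin_order_top_greater: "a \<in> K \<Longrightarrow> openin (order_top K) {x\<in>K. a < x}"
  unfolding order_top_def by (rule topology_generated_by_Basis) auto

lemma closedin_order_top_atMost:
  assumes "a \<in> K" shows "closedin (order_top K) {x\<in>K. x \<le> a}"
proof -
  have "K - {x\<in>K. x \<le> a} = {x\<in>K. a < x}" by auto
  then show ?thesis
    using openin_order_top_greater[OF assms] by (auto simp: closedin_def)
qed

lemma closedin_order_top_atLeast:
  assumes "a \<in> K" shows "closedin (order_top K) {x\<in>K. a \<le> x}"
proof -
  have "K - {x\<in>K. a \<le> x} = {x\<in>K. x < a}" by auto
  then show ?thesis
    using openin_order_top_less[OF assms] by (auto simp: closedin_def)
qed

lemma continuous_map_into_order_top:
  assumes "f \<in> topspace X \<rightarrow> K"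
    and "\<And>a. a \<in> K \<Longrightarrow> openin X {x \<in> topspace X. f x < a}"
    and "\<And>a. a \<in> K \<Longrightarrow> openin X {x \<in> topspace X. a < f x}"
  shows "continuous_map X (order_top K) f"
  unfolding order_top_def
proof (rule continuous_on_generated_topo)
  fix U assume "U \<in> insert K ((\<lambda>a. {x\<in>K. x < a}) ` K \<union> (\<lambda>a. {x\<in>K. a < x}) ` K)"
  then consider "U = K" | a where "a \<in> K" "U = {x\<in>K. x < a}" | a where "a \<in> K" "U = {x\<in>K. a < x}"
    by auto
  then show "openin X (f -` U \<inter> topspace X)"
  proof cases
    case 1
    then have "f -` U \<inter> topspace X = topspace X" using assms(1) by auto
    then show ?thesis by simp
  next
    case 2
    then have "f -` U \<inter> topspace X = {x \<in> topspace X. f x < a}" using assms(1) by auto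
    then show ?thesis using assms(2) 2 by simp
  next
    case 3
    then have "f -` U \<inter> topspace X = {x \<in> topspace X. a < f x}" using assms(1) by auto
    then show ?thesis using assms(3) 3 by simp
  qed
next
  show "f ` topspace X \<subseteq> \<Union> (insert K ((\<lambda>a. {x\<in>K. x < a}) ` K \<union> (\<lambda>a. {x\<in>K. a < x}) ` K))"
    using assms(1) by auto
qed

lemma Hausdorff_order_top: "Hausdorff_space (order_top K)"
proof -
  have sep: "\<exists>U V. openin (order_top K) U \<and> openin (order_top K) V \<and> x \<in> U \<and> y \<in> V \<and> disjnt U V"
    if xy: "x \<in> K" "y \<in> K" "x < y" for x y
  proof (cases "\<exists>z\<in>K. x < z \<and> z < y")
    case True
    then obtain z where z: "z \<in> K" "x < z" "z < y" by auto
    show ?thesis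
      by (rule exI[of _ "{u\<in>K. u < z}"], rule exI[of _ "{u\<in>K. z < u}"])
        (use xy z in \<open>auto simp: openin_order_top_less openin_order_top_greater disjnt_def\<close>)
  next
    case False
    show ?thesis
      by (rule exI[of _ "{u\<in>K. u < y}"], rule exI[of _ "{u\<in>K. x < u}"])
        (use xy False in \<open>auto simp: openin_order_top_less openin_order_top_greater disjnt_def\<close>)
  qed
  show ?thesis
    unfolding Hausdorff_space_def topspace_order_top
  proof (intro allI impI)
    fix x y assume xy: "x \<in> K \<and> y \<in> K \<and> x \<noteq> y"
    then consider "x < y" | "y < x" by force
    then show "\<exists>U V. openin (order_top K) U \<and> openin (order_top K) V \<and> x \<in> U \<and> y \<in> V \<and> disjnt U V"
    proof cases
      case 1
      then show ?thesis using sep[of x y] xy by simp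
    next
      case 2
      then show ?thesis using sep[of y x] xy by (meson disjnt_sym)
    qed
  qed
qed

lemma compact_space_order_top: "compact_line K \<Longrightarrow> compact_space (order_top K)"
  by (simp add: compact_line_def compact_space_def)

lemma normal_space_order_top: "compact_line K \<Longrightarrow> normal_space (order_top K)"
  by (simp add: Hausdorff_order_top compact_Hausdorff_or_regular_imp_normal_space compact_space_order_top)

text \<open>If no point of \<open>C\<close> were least, the open rays above points of
  \<open>C\<close> would cover \<open>C\<close>. A finite subcover uses finitely many endpoints, and
  the smallest of these lies in none of the rays.\<close>

lemma compactin_order_top_has_min:
  assumes C: "compactin (order_top K) C" and "C \<noteq> {}"
  obtains m where "m \<in> C" "\<And>x. x \<in> C \<Longrightarrow> m \<le> x"
proof -
  have "\<exists>m\<in>C. \<forall>x\<in>C. m \<le> x"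
  proof (rule ccontr)
    assume no_min: "\<not> ?thesis"
    have CK: "C \<subseteq> K" using compactin_subset_topspace[OF C] by simp
    let ?U = "(\<lambda>a. {x\<in>K. a < x}) ` C"
    have cov: "C \<subseteq> \<Union>?U" using no_min CK by (force simp: not_le)
    have op: "\<And>V. V \<in> ?U \<Longrightarrow> openin (order_top K) V"
      using CK openin_order_top_greater by auto
    obtain \<F> where \<F>: "finite \<F>" "\<F> \<subseteq> ?U" "C \<subseteq> \<Union>\<F>"
      using compactinD[OF C op cov] by auto
    then obtain A where A: "A \<subseteq> C" "finite A" "\<F> = (\<lambda>a. {x\<in>K. a < x}) ` A"
      using finite_subset_image[OF \<F>(1,2)] by blast
    then have "A \<noteq> {}" using \<F> \<open>C \<noteq> {}\<close> by auto
    then have "Min A \<in> C" using A Min_in by blast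
    moreover have "Min A \<in> \<Union>\<F>" using calculation \<F>(3) by blast
    ultimately obtain a where "a \<in> A" "a < Min A" using A(3) by auto
    then show False using A by (meson Min_le leD)
  qed
  then show ?thesis using that by blast
qed

lemma compactin_order_top_has_max:
  assumes C: "compactin (order_top K) C" and "C \<noteq> {}"
  obtains m where "m \<in> C" "\<And>x. x \<in> C \<Longrightarrow> x \<le> m"
proof -
  have "\<exists>m\<in>C. \<forall>x\<in>C. x \<le> m"
  proof (rule ccontr)
    assume no_max: "\<not> ?thesis"
    have CK: "C \<subseteq> K" using compactin_subset_topspace[OF C] by simp
    let ?U = "(\<lambda>a. {x\<in>K. x < a}) ` C"
    have cov: "C \<subseteq> \<Union>?U" using no_max CK by (force simp: not_le)
    have op: "\<And>V. V \<in> ?U \<Longrightarrow> openin (order_top K) V"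
      using CK openin_order_top_less by auto
    obtain \<F> where \<F>: "finite \<F>" "\<F> \<subseteq> ?U" "C \<subseteq> \<Union>\<F>"
      using compactinD[OF C op cov] by auto
    then obtain A where A: "A \<subseteq> C" "finite A" "\<F> = (\<lambda>a. {x\<in>K. x < a}) ` A"
      using finite_subset_image[OF \<F>(1,2)] by blast
    then have "A \<noteq> {}" using \<F> \<open>C \<noteq> {}\<close> by auto
    then have "Max A \<in> C" using A Max_in by blast
    moreover have "Max A \<in> \<Union>\<F>" using calculation \<F>(3) by blast
    ultimately obtain a where "a \<in> A" "Max A < a" using A(3) by auto
    then show False using A by (meson Max_ge leD)
  qed
  then show ?thesis using that by blast
qed

text \<open>Only the right half of a neighbourhood matters later. The point \<open>y\<close>
  supplies the endpoint \<open>u\<close> whenever a subbasic set does not bound \<open>x\<close>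
  from the right.\<close>

lemma openin_order_top_right_interval:
  assumes "openin (order_top K) U" "x \<in> U" "y \<in> K" "x < y"
  obtains u where "u \<in> K" "x < u" "{z\<in>K. x \<le> z \<and> z < u} \<subseteq> U"
proof -
  have "generate_topology_on (insert K ((\<lambda>a. {x\<in>K. x < a}) ` K \<union> (\<lambda>a. {x\<in>K. a < x}) ` K)) U"
    using assms(1) unfolding order_top_def by (rule openin_topology_generated_by)
  then have "x \<in> U \<longrightarrow> (\<exists>u\<in>K. x < u \<and> {z\<in>K. x \<le> z \<and> z < u} \<subseteq> U)"
  proof induction
    case (Int A B)
    show ?case
    proof
      assume "x \<in> A \<inter> B"
      then obtain u v where "u \<in> K" "x < u" "{z\<in>K. x \<le> z \<and> z < u} \<subseteq> A"
          "v \<in> K" "x < v" "{z\<in>K. x \<le> z \<and> z < v} \<subseteq> B"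
        using Int.IH by auto
      then show "\<exists>u\<in>K. x < u \<and> {z\<in>K. x \<le> z \<and> z < u} \<subseteq> A \<inter> B"
        by (intro bexI[of _ "min u v"]) (auto simp: min_def)
    qed
  next
    case (UN \<F>)
    show ?case
    proof
      assume "x \<in> \<Union>\<F>"
      then obtain k where "k \<in> \<F>" "x \<in> k" by auto
      then obtain u where "u \<in> K" "x < u" "{z\<in>K. x \<le> z \<and> z < u} \<subseteq> k" using UN.IH by auto
      then show "\<exists>u\<in>K. x < u \<and> {z\<in>K. x \<le> z \<and> z < u} \<subseteq> \<Union>\<F>"
        using \<open>k \<in> \<F>\<close> by blast
    qed
  next
    case (Basis s)
    then consider "s = K" | a where "a \<in> K" "s = {x\<in>K. x < a}" | a where "a \<in> K" "s = {x\<in>K. a < x}"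
      by auto
    then show ?case using assms(3,4) by cases auto
  qed auto
  then show ?thesis using assms(2) that by blast
qed

text \<open>For an arbitrary subset the order topology can be strictly coarser than the subspace
  topology. For an interval they agree, because a ray of \<open>K\<close> with endpoint outside the
  interval meets it in nothing or in everything.\<close>

lemma order_top_atLeastAtMost:
  assumes ab: "a \<in> K" "b \<in> K" "a \<le> b"
  shows "order_top {x\<in>K. a \<le> x \<and> x \<le> b} = subtopology (order_top K) {x\<in>K. a \<le> x \<and> x \<le> b}"
    (is "order_top ?J = ?Y")
proof -
  have top: "topspace ?Y = ?J" by auto
  have 1: "continuous_map ?Y (order_top ?J) id"
  proof (rule continuous_map_into_order_top)
    show "id \<in> topspace ?Y \<rightarrow> ?J" by auto
    fix c assume "c \<in> ?J"
    then have "c \<in> K" by simp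
    have "{x \<in> topspace ?Y. id x < c} = {x\<in>K. x < c} \<inter> ?J"
      "{x \<in> topspace ?Y. c < id x} = {x\<in>K. c < x} \<inter> ?J" by auto
    then show "openin ?Y {x \<in> topspace ?Y. id x < c}" "openin ?Y {x \<in> topspace ?Y. c < id x}"
      using openin_order_top_less[OF \<open>c \<in> K\<close>] openin_order_top_greater[OF \<open>c \<in> K\<close>]
      by (auto simp: openin_subtopology)
  qed
  have "continuous_map (order_top ?J) (order_top K) id"
  proof (rule continuous_map_into_order_top)
    fix c assume "c \<in> K"
    consider "c < a" | "b < c" | "c \<in> ?J" using \<open>c \<in> K\<close> by force
    then show "openin (order_top ?J) {x \<in> topspace (order_top ?J). id x < c}"
    proof cases
      case 1
      then have "{x \<in> topspace (order_top ?J). id x < c} = {}" by auto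
      then show ?thesis by (simp only: openin_empty)
    next
      case 2
      then have "{x \<in> topspace (order_top ?J). id x < c} = topspace (order_top ?J)" by auto
      then show ?thesis by (simp only: openin_topspace)
    next
      case 3
      then show ?thesis using openin_order_top_less[OF 3] by simp
    qed
    consider "c < a" | "b < c" | "c \<in> ?J" using \<open>c \<in> K\<close> by force
    then show "openin (order_top ?J) {x \<in> topspace (order_top ?J). c < id x}"
    proof cases
      case 1
      then have "{x \<in> topspace (order_top ?J). c < id x} = topspace (order_top ?J)" by auto
      then show ?thesis by (simp only: openin_topspace)
    next
      case 2
      then have "{x \<in> topspace (order_top ?J). c < id x} = {}" by auto
      then show ?thesis by (simp only: openin_empty)
    next
      case 3
      then show ?thesis using openin_order_top_greater[OF 3] by simp
    qed
  qed auto
  then have 2: "continuous_map (order_top ?J) ?Y id"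
    by (auto simp: continuous_map_in_subtopology)
  have "openin (order_top ?J) U \<longleftrightarrow> openin ?Y U" for U
  proof
    assume U: "openin (order_top ?J) U"
    then have "U \<subseteq> ?J" using openin_subset[OF U] by auto
    then have "{x \<in> topspace ?Y. id x \<in> U} = U" by auto
    then show "openin ?Y U" using openin_continuous_map_preimage[OF 1 U] by simp
  next
    assume U: "openin ?Y U"
    then have "U \<subseteq> ?J" using openin_subset[OF U] by auto
    then have "{x \<in> topspace (order_top ?J). id x \<in> U} = U" by auto
    then show "openin (order_top ?J) U" using openin_continuous_map_preimage[OF 2 U] by simp
  qed
  then show ?thesis by (simp add: topology_eq)
qed

lemma compact_line_atLeastAtMost:
  assumes "compact_line K" and ab: "a \<in> K" "b \<in> K" "a \<le> b"
  shows "compact_line {x\<in>K. a \<le> x \<and> x \<le> b}"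
proof -
  have "{x\<in>K. a \<le> x \<and> x \<le> b} = {x\<in>K. a \<le> x} \<inter> {x\<in>K. x \<le> b}" by auto
  then have "closedin (order_top K) {x\<in>K. a \<le> x \<and> x \<le> b}"
    using closedin_Int[OF closedin_order_top_atLeast[OF ab(1)] closedin_order_top_atMost[OF ab(2)]]
    by (simp only:)
  then have "compactin (order_top K) {x\<in>K. a \<le> x \<and> x \<le> b}"
    using closedin_compact_space compact_space_order_top assms(1) by blast
  then show ?thesis
    unfolding compact_line_def order_top_atLeastAtMost[OF ab]
    using ab by (auto simp: compactin_subtopology)
qed

text \<open>The retraction onto the interval sends everything below to \<open>a\<close> and
  everything above to \<open>b\<close>. Preimages of rays are the same rays of \<open>K\<close>,
  except that the rays strictly below \<open>a\<close> or strictly above \<open>b\<close> have empty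
  preimage.\<close>

lemma continuous_map_clamp:
  assumes ab: "a \<in> K" "b \<in> K" "a \<le> b"
  shows "continuous_map (order_top K) (order_top {x\<in>K. a \<le> x \<and> x \<le> b}) (\<lambda>x. max a (min x b))"
proof (rule continuous_map_into_order_top)
  show "(\<lambda>x. max a (min x b)) \<in> topspace (order_top K) \<rightarrow> {x\<in>K. a \<le> x \<and> x \<le> b}"
    using ab by (auto simp: max_def min_def)
  fix c assume c: "c \<in> {x\<in>K. a \<le> x \<and> x \<le> b}"
  have "{x \<in> topspace (order_top K). max a (min x b) < c} = (if c = a then {} else {x\<in>K. x < c})"
    using c by (auto simp: min_less_iff_disj)
  then show "openin (order_top K) {x \<in> topspace (order_top K). max a (min x b) < c}"
    using c by (auto simp: openin_order_top_less)
  have "{x \<in> topspace (order_top K). c < max a (min x b)} = (if c = b then {} else {x\<in>K. c < x})"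
    using c by (auto simp: less_max_iff_disj)
  then show "openin (order_top K) {x \<in> topspace (order_top K). c < max a (min x b)}"
    using c by (auto simp: openin_order_top_greater)
qed

lemma order_top_Urysohn:
  assumes K: "compact_line K" and su: "s \<in> K" "u \<in> K" "s < u"
  shows "\<exists>g. continuous_map (order_top K) euclideanreal g \<and> (\<forall>x\<in>K. 0 \<le> g x \<and> g x \<le> 1) \<and>
    (\<forall>x\<in>K. x \<le> s \<longrightarrow> g x = 1) \<and> (\<forall>x\<in>K. u \<le> x \<longrightarrow> g x = 0)"
proof -
  have "disjnt {x\<in>K. u \<le> x} {x\<in>K. x \<le> s}" using su by (auto simp: disjnt_def)
  then obtain g where g: "continuous_map (order_top K) (top_of_set {0..1::real}) g"
    "g ` {x\<in>K. u \<le> x} \<subseteq> {0}" "g ` {x\<in>K. x \<le> s} \<subseteq> {1}"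
    using Urysohn_lemma[OF normal_space_order_top[OF K] closedin_order_top_atLeast[OF su(2)]
      closedin_order_top_atMost[OF su(1)], of 0 1] by auto
  have "continuous_map (order_top K) euclideanreal g"
    using g(1) by (simp add: continuous_map_in_subtopology)
  moreover have "0 \<le> g x \<and> g x \<le> 1" if "x \<in> K" for x
    using g(1) that by (auto simp: continuous_map_in_subtopology Pi_iff)
  ultimately show ?thesis using g(2,3) by (intro exI[of _ g]) auto
qed

section \<open>Radon measures on compact lines\<close>

text \<open>The integral against the signed measure \<open>M - N\<close>. The pair need not be the
  Jordan decomposition, so cancellation between \<open>M\<close> and \<open>N\<close> is
  possible.\<close>

definition pairing :: "'a measure \<Rightarrow> 'a measure \<Rightarrow> ('a \<Rightarrow> real) \<Rightarrow> real" where
  "pairing M N f = integral\<^sup>L M f - integral\<^sup>L N f"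

lemma space_order_borel [simp]: "space (order_borel K) = K"
  unfolding order_borel_def by (simp add: space_measure_of_conv)

lemma sets_order_borel: "sets (order_borel K) = sigma_sets K {U. openin (order_top K) U}"
  unfolding order_borel_def using openin_subset by (subst sets_measure_of) fastforce+

lemma openin_sets_order_borel: "openin (order_top K) U \<Longrightarrow> U \<in> sets (order_borel K)"
  by (simp add: sets_order_borel sigma_sets.Basic)

lemma closedin_sets_order_borel:
  assumes "closedin (order_top K) C" shows "C \<in> sets (order_borel K)"
proof -
  have "K - C \<in> sets (order_borel K)"
    using assms by (intro openin_sets_order_borel) (auto simp: closedin_def)
  then have "K - (K - C) \<in> sets (order_borel K)"
    by (metis sets.compl_sets space_order_borel)
  moreover have "K - (K - C) = C" using closedin_subset[OF assms] by auto
  ultimately show ?thesis by simp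
qed

lemma compactin_sets_order_borel: "compactin (order_top K) C \<Longrightarrow> C \<in> sets (order_borel K)"
  by (simp add: Hausdorff_order_top closedin_sets_order_borel compactin_imp_closedin)

lemma measurable_order_borel:
  assumes f: "continuous_map (order_top K) (order_top L) f"
  shows "f \<in> measurable (order_borel K) (order_borel L)"
proof (rule measurable_sigma_sets[OF sets_order_borel])
  show "{U. openin (order_top L) U} \<subseteq> Pow L" using openin_subset by fastforce
  show "f \<in> space (order_borel K) \<rightarrow> L" using continuous_map_image_subset_topspace[OF f] by auto
  fix U assume "U \<in> {U. openin (order_top L) U}"
  then have "openin (order_top K) {x \<in> topspace (order_top K). f x \<in> U}"
    using openin_continuous_map_preimage[OF f] by blast
  moreover have "{x \<in> topspace (order_top K). f x \<in> U} = f -` U \<inter> space (order_borel K)" by auto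
  ultimately show "f -` U \<inter> space (order_borel K) \<in> sets (order_borel K)"
    by (simp add: openin_sets_order_borel)
qed

lemma borel_measurable_order_borel:
  assumes f: "continuous_map (order_top K) euclideanreal f"
  shows "f \<in> borel_measurable (order_borel K)"
proof (rule borel_measurableI)
  fix U :: "real set" assume "open U"
  then have "openin (order_top K) {x \<in> topspace (order_top K). f x \<in> U}"
    using openin_continuous_map_preimage[OF f] by simp
  moreover have "{x \<in> topspace (order_top K). f x \<in> U} = f -` U \<inter> space (order_borel K)" by auto
  ultimately show "f -` U \<inter> space (order_borel K) \<in> sets (order_borel K)"
    by (simp add: openin_sets_order_borel)
qed

lemma radon_on_sets: "radon_on K M \<Longrightarrow> sets M = sets (order_borel K)"
  by (simp add: radon_on_def)

lemma radon_on_space: "radon_on K M \<Longrightarrow> space M = K"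
  using radon_on_sets sets_eq_imp_space_eq space_order_borel by metis

lemma radon_on_finite: "radon_on K M \<Longrightarrow> finite_measure M"
  by (simp add: radon_on_def)

lemma radon_on_measurable:
  assumes "radon_on K M" "continuous_map (order_top K) euclideanreal f"
  shows "f \<in> borel_measurable M"
  using borel_measurable_order_borel[OF assms(2)] measurable_cong_sets radon_on_sets[OF assms(1)] by blast

lemma radon_on_integrable_bounded:
  assumes M: "radon_on K M" and f: "continuous_map (order_top K) euclideanreal f"
    and c: "\<And>x. x \<in> K \<Longrightarrow> \<bar>f x\<bar> \<le> c"
  shows "integrable M f"
proof -
  interpret finite_measure M using radon_on_finite[OF M] .
  show ?thesis
    by (rule integrable_const_bound[of _ c])
      (use c radon_on_measurable[OF M f] radon_on_space[OF M] in auto)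
qed

lemma order_top_continuous_bounded:
  assumes "compact_line K" "continuous_map (order_top K) euclideanreal f"
  obtains c where "\<And>x. x \<in> K \<Longrightarrow> \<bar>f x\<bar> \<le> (c::real)"
proof -
  have "compact (f ` K)"
    using image_compactin[OF _ assms(2), of K] assms(1) by (simp add: compact_line_def)
  then obtain c where "\<forall>y\<in>f ` K. norm y \<le> c"
    using compact_imp_bounded bounded_iff by metis
  then show ?thesis using that by auto
qed

lemma radon_on_integrable:
  assumes "compact_line K" "radon_on K M" "continuous_map (order_top K) euclideanreal f"
  shows "integrable M f"
  using order_top_continuous_bounded[OF assms(1,3)] radon_on_integrable_bounded[OF assms(2,3)] by metis

lemma radon_on_sets_order:
  assumes M: "radon_on K M" and s: "s \<in> K"
  shows "{x\<in>K. x \<le> s} \<in> sets M" "{x\<in>K. x < s} \<in> sets M" "{x\<in>K. s < x} \<in> sets M" "{x\<in>K. s \<le> x} \<in> sets M"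
  using openin_order_top_less[OF s] openin_order_top_greater[OF s] closedin_order_top_atMost[OF s]
    closedin_order_top_atLeast[OF s] radon_on_sets[OF M]
  by (simp_all add: openin_sets_order_borel closedin_sets_order_borel)

lemma radon_on_sets_gap:
  assumes M: "radon_on K M" and su: "s \<in> K" "u \<in> K"
  shows "{x\<in>K. s < x \<and> x < u} \<in> sets M"
proof -
  have "{x\<in>K. s < x \<and> x < u} = {x\<in>K. s < x} \<inter> {x\<in>K. x < u}" by auto
  then show ?thesis using radon_on_sets_order[OF M] su by auto
qed

text \<open>By inner regularity of the ray above \<open>s\<close>, a compact \<open>C\<close>
  carries all but \<open>e\<close> of its mass, and the part of the ray below the minimum of
  \<open>C\<close> misses \<open>C\<close>.\<close>

lemma radon_on_small_gap:
  assumes M: "radon_on K M" and s: "s \<in> K" "y \<in> K" "s < y" and e: "0 < (e::real)"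
  obtains u where "u \<in> K" "s < u" "measure M {x\<in>K. s < x \<and> x < u} < e"
proof -
  interpret finite_measure M using radon_on_finite[OF M] .
  let ?A = "{x\<in>K. s < x}"
  have A: "?A \<in> sets M" using radon_on_sets_order[OF M s(1)] by simp
  have "\<exists>C. compactin (order_top K) C \<and> C \<subseteq> ?A \<and> measure M ?A - e < measure M C"
  \<comment> \<open>Splitting off this case keeps \<open>measure M ?A - e\<close> nonnegative in the
    other one, as the passage through \<open>ennreal\<close> requires.\<close>
  proof (cases "measure M ?A < e")
    case True
    then show ?thesis by (intro exI[of _ "{}"]) simp
  next
    case False
    have "ennreal (measure M ?A - e) < emeasure M ?A"
      unfolding emeasure_eq_measure using False e by (simp add: ennreal_less_iff)
    also have "emeasure M ?A = (SUP C\<in>{C. compactin (order_top K) C \<and> C \<subseteq> ?A}. emeasure M C)"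
      using M A by (auto simp: radon_on_def)
    finally obtain C where C: "compactin (order_top K) C" "C \<subseteq> ?A" "ennreal (measure M ?A - e) < emeasure M C"
      unfolding less_SUP_iff by auto
    then have "measure M ?A - e < measure M C"
      using False by (simp add: emeasure_eq_measure ennreal_less_iff)
    then show ?thesis using C by auto
  qed
  then obtain C where C: "compactin (order_top K) C" "C \<subseteq> ?A" "measure M ?A - e < measure M C"
    by auto
  obtain u where u: "u \<in> K" "s < u" "C \<subseteq> {x\<in>K. u \<le> x}"
  proof (cases "C = {}")
    case True
    then show ?thesis using that s by auto
  next
    case False
    then obtain m where "m \<in> C" "\<And>x. x \<in> C \<Longrightarrow> m \<le> x"
      using compactin_order_top_has_min[OF C(1)] by metis
    then show ?thesis using that[of m] C(2) by auto
  qed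
  have Cs: "C \<in> sets M" using compactin_sets_order_borel[OF C(1)] radon_on_sets[OF M] by simp
  have G: "{x\<in>K. s < x \<and> x < u} \<in> sets M" using radon_on_sets_gap[OF M] s u by simp
  have "{x\<in>K. s < x \<and> x < u} \<inter> C = {}" using u by force
  then have "measure M {x\<in>K. s < x \<and> x < u} + measure M C = measure M ({x\<in>K. s < x \<and> x < u} \<union> C)"
    using finite_measure_Union[OF G Cs] by simp
  also have "\<dots> \<le> measure M ?A"
    by (rule finite_measure_mono) (use A C(2) in auto)
  finally show ?thesis using that[OF u(1,2)] C(3) by linarith
qed

text \<open>\<open>g\<close> is squeezed between the indicators of
  \<open>{x\<in>K. x \<le> s}\<close> and \<open>{x\<in>K. x < u}\<close>. Values of the
  distribution function are thus integrals of continuous functions up to the mass of an open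
  gap.\<close>

lemma integral_gap:
  assumes M: "radon_on K M" and su: "s \<in> K" "u \<in> K"
    and g: "continuous_map (order_top K) euclideanreal g" "\<And>x. x \<in> K \<Longrightarrow> 0 \<le> g x \<and> g x \<le> 1"
      "\<And>x. \<lbrakk>x \<in> K; x \<le> s\<rbrakk> \<Longrightarrow> g x = 1" "\<And>x. \<lbrakk>x \<in> K; u \<le> x\<rbrakk> \<Longrightarrow> g x = 0"
  shows "measure M {x\<in>K. x \<le> s} \<le> integral\<^sup>L M g"
    "integral\<^sup>L M g \<le> measure M {x\<in>K. x \<le> s} + measure M {x\<in>K. s < x \<and> x < u}"
proof -
  interpret finite_measure M using radon_on_finite[OF M] .
  have S: "space M = K" using radon_on_space[OF M] .
  let ?A = "{x\<in>K. x \<le> s}" and ?G = "{x\<in>K. s < x \<and> x < u}"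
  have A: "?A \<in> sets M" using radon_on_sets_order[OF M su(1)] by simp
  have G: "?G \<in> sets M" using radon_on_sets_gap[OF M su] .
  have ig: "integrable M g"
    by (rule radon_on_integrable_bounded[OF M g(1), of 1]) (use g(2) in force)
  have iA: "integrable M (indicator ?A :: _ \<Rightarrow> real)" and iG: "integrable M (indicator ?G :: _ \<Rightarrow> real)"
    using A G by (auto simp: emeasure_eq_measure)
  have "integral\<^sup>L M (indicator ?A) \<le> integral\<^sup>L M g"
    by (rule integral_mono[OF iA ig]) (use g S in \<open>auto simp: indicator_def\<close>)
  then show "measure M ?A \<le> integral\<^sup>L M g" using A by simp
  have "integral\<^sup>L M g \<le> integral\<^sup>L M (\<lambda>x. indicator ?A x + indicator ?G x)"
    by (rule integral_mono[OF ig Bochner_Integration.integrable_add[OF iA iG]])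
      (use g S in \<open>auto simp: indicator_def not_less not_le\<close>)
  also have "\<dots> = measure M ?A + measure M ?G"
    using iA iG A G by simp
  finally show "integral\<^sup>L M g \<le> measure M ?A + measure M ?G" .
qed

lemma pairing_gap:
  assumes F: "associated K F M N" and su: "s \<in> K" "u \<in> K"
    and g: "continuous_map (order_top K) euclideanreal g" "\<And>x. x \<in> K \<Longrightarrow> 0 \<le> g x \<and> g x \<le> 1"
      "\<And>x. \<lbrakk>x \<in> K; x \<le> s\<rbrakk> \<Longrightarrow> g x = 1" "\<And>x. \<lbrakk>x \<in> K; u \<le> x\<rbrakk> \<Longrightarrow> g x = 0"
  shows "\<bar>pairing M N g - F s\<bar> \<le> measure M {x\<in>K. s < x \<and> x < u} + measure N {x\<in>K. s < x \<and> x < u}"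
proof -
  have M: "radon_on K M" and N: "radon_on K N"
    and Fs: "F s = measure M {s'\<in>K. s' \<le> s} - measure N {s'\<in>K. s' \<le> s}"
    using F su by (auto simp: associated_def)
  show ?thesis
    unfolding pairing_def Fs
    using integral_gap[OF M su g] integral_gap[OF N su g] by linarith
qed

lemma associated_small_gap:
  assumes F: "associated K F M N" and s: "s \<in> K" "y \<in> K" "s < y" and e: "0 < (e::real)"
  shows "\<exists>u\<in>K. s < u \<and> measure M {x\<in>K. s < x \<and> x < u} + measure N {x\<in>K. s < x \<and> x < u} < e"
proof -
  have M: "radon_on K M" and N: "radon_on K N" using F by (auto simp: associated_def)
  obtain u where u: "u \<in> K" "s < u" "measure M {x\<in>K. s < x \<and> x < u} < e/2"
    using radon_on_small_gap[OF M s, of "e/2"] e by auto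
  obtain v where v: "v \<in> K" "s < v" "measure N {x\<in>K. s < x \<and> x < v} < e/2"
    using radon_on_small_gap[OF N s, of "e/2"] e by auto
  let ?w = "min u v"
  have "measure M {x\<in>K. s < x \<and> x < ?w} \<le> measure M {x\<in>K. s < x \<and> x < u}"
    by (rule finite_measure.finite_measure_mono[OF radon_on_finite[OF M] _ radon_on_sets_gap[OF M s(1) u(1)]]) auto
  moreover have "measure N {x\<in>K. s < x \<and> x < ?w} \<le> measure N {x\<in>K. s < x \<and> x < v}"
    by (rule finite_measure.finite_measure_mono[OF radon_on_finite[OF N] _ radon_on_sets_gap[OF N s(1) v(1)]]) auto
  moreover have "?w \<in> K" "s < ?w" using u v by (auto simp: min_def)
  ultimately show ?thesis using u(3) v(3) by (intro bexI[of _ ?w]) linarith+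
qed

text \<open>Separable determination asks for members of \<open>NBV\<close>, so this has to be
  verified for push-forwards. The distribution function \<open>V\<close> of \<open>M + N\<close>
  dominates the increments of \<open>F\<close>.\<close>

lemma associated_NBV:
  assumes F: "associated K F M N"
  shows "F \<in> NBV K"
proof -
  have M: "radon_on K M" and N: "radon_on K N"
    and Fs: "\<And>t. t \<in> K \<Longrightarrow> F t = measure M {s\<in>K. s \<le> t} - measure N {s\<in>K. s \<le> t}"
    using F by (auto simp: associated_def)
  interpret M: finite_measure M using radon_on_finite[OF M] .
  interpret N: finite_measure N using radon_on_finite[OF N] .
  define V where "V t = measure M {s\<in>K. s \<le> t} + measure N {s\<in>K. s \<le> t}" for t
  have diff: "measure R {s\<in>K. s \<le> t} \<le> measure R {s\<in>K. s \<le> t'}"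
    if "radon_on K R" "t \<in> K" "t' \<in> K" "t \<le> t'" for R t t'
    by (rule finite_measure.finite_measure_mono[OF radon_on_finite[OF that(1)]])
      (use radon_on_sets_order[OF that(1)] that in auto)
  have FV: "\<bar>F t' - F t\<bar> \<le> V t' - V t" if "t \<in> K" "t' \<in> K" "t \<le> t'" for t t'
    using diff[OF M that] diff[OF N that] by (simp add: V_def Fs that)
  have Vb: "0 \<le> V t" "V t \<le> measure M (space M) + measure N (space N)" for t
    by (auto simp: V_def intro!: add_mono M.bounded_measure N.bounded_measure)
  have Vgap: "measure R {s\<in>K. s \<le> t'} \<le> measure R {s\<in>K. s \<le> t} + measure R {x\<in>K. t < x \<and> x < u}"
    if R: "radon_on K R" and t: "t \<in> K" "t' \<in> K" "u \<in> K" "t \<le> t'" "t' < u" for R t t' u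
  proof -
    interpret R: finite_measure R using radon_on_finite[OF R] .
    have "measure R {s\<in>K. s \<le> t'} \<le> measure R ({s\<in>K. s \<le> t} \<union> {x\<in>K. t < x \<and> x < u})"
      by (rule R.finite_measure_mono)
        (use t radon_on_sets_order[OF R t(1)] radon_on_sets_gap[OF R t(1,3)] in auto)
    also have "\<dots> \<le> measure R {s\<in>K. s \<le> t} + measure R {x\<in>K. t < x \<and> x < u}"
      by (rule measure_Un_le) (use radon_on_sets_order[OF R t(1)] radon_on_sets_gap[OF R t(1,3)] in auto)
    finally show ?thesis .
  qed
  have "right_continuous_on K F"
    unfolding right_continuous_on_def
  proof (intro ballI impI allI)
    fix t and e :: real assume t: "t \<in> K" "\<exists>y\<in>K. t < y" "0 < e"
    then obtain y where y: "y \<in> K" "t < y" by auto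
    obtain u where u: "u \<in> K" "t < u"
      "measure M {x\<in>K. t < x \<and> x < u} + measure N {x\<in>K. t < x \<and> x < u} < e"
      using associated_small_gap[OF F t(1) y t(3)] by blast
    have "\<bar>F s - F t\<bar> < e" if "s \<in> K" "t \<le> s" "s < u" for s
      using FV[OF t(1) that(1,2)] Vgap[OF M t(1) that(1) u(1) that(2,3)]
        Vgap[OF N t(1) that(1) u(1) that(2,3)] u(3) by (simp add: V_def)
    then show "\<exists>u\<in>K. t < u \<and> (\<forall>s\<in>K. t \<le> s \<and> s < u \<longrightarrow> \<bar>F s - F t\<bar> < e)"
      using u by blast
  qed
  moreover have "bounded_variation_on K F"
    unfolding bounded_variation_on_def
  proof (intro exI allI impI)
    fix ts assume ts: "sorted_wrt (<) ts \<and> set ts \<subseteq> K"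
    have "\<bar>F (ts ! Suc k) - F (ts ! k)\<bar> \<le> V (ts ! Suc k) - V (ts ! k)" if "k < length ts - 1" for k
    proof (rule FV)
      show "ts ! k \<in> K" "ts ! Suc k \<in> K" using ts that nth_mem by auto
      show "ts ! k \<le> ts ! Suc k" using ts that sorted_wrt_nth_less[of "(<)" ts k "Suc k"] by (simp add: less_imp_le)
    qed
    then have "(\<Sum>k<length ts - 1. \<bar>F (ts ! Suc k) - F (ts ! k)\<bar>)
        \<le> (\<Sum>k<length ts - 1. V (ts ! Suc k) - V (ts ! k))"
      by (intro sum_mono) auto
    also have "\<dots> = V (ts ! (length ts - 1)) - V (ts ! 0)"
      by (rule sum_lessThan_telescope)
    also have "\<dots> \<le> measure M (space M) + measure N (space N)" using Vb by (smt (verit))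
    finally show "(\<Sum>k<length ts - 1. \<bar>F (ts ! Suc k) - F (ts ! k)\<bar>)
      \<le> measure M (space M) + measure N (space N)" .
  qed
  ultimately show ?thesis by (simp add: NBV_def)
qed

text \<open>Inner regularity passes to the image because a compact subset of the preimage of
  \<open>A\<close> has a compact image inside \<open>A\<close>, and the preimage of that image is at
  least as large.\<close>

lemma radon_on_distr:
  assumes M: "radon_on K M" and f: "continuous_map (order_top K) (order_top L) f"
  shows "radon_on L (distr M (order_borel L) f)"
proof -
  interpret finite_measure M using radon_on_finite[OF M] .
  let ?D = "distr M (order_borel L) f"
  have fm: "f \<in> measurable M (order_borel L)"
    using measurable_order_borel[OF f] measurable_cong_sets radon_on_sets[OF M] by blast
  have "emeasure ?D A = (SUP C\<in>{C. compactin (order_top L) C \<and> C \<subseteq> A}. emeasure ?D C)"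
    (is "_ = ?S") if A: "A \<in> sets ?D" for A
  proof (rule antisym)
    let ?B = "f -` A \<inter> space M"
    have B: "?B \<in> sets M" using fm A by (simp add: measurable_sets)
    have "emeasure ?D A = emeasure M ?B" using fm A by (simp add: emeasure_distr)
    also have "\<dots> = (SUP C\<in>{C. compactin (order_top K) C \<and> C \<subseteq> ?B}. emeasure M C)"
      using M B by (auto simp: radon_on_def)
    also have "\<dots> \<le> ?S"
    proof (rule SUP_least)
      fix C assume "C \<in> {C. compactin (order_top K) C \<and> C \<subseteq> ?B}"
      then have C: "compactin (order_top K) C" "C \<subseteq> ?B" by auto
      have fC: "compactin (order_top L) (f ` C)" using image_compactin[OF C(1) f] .
      then have fCs: "f ` C \<in> sets (order_borel L)" by (rule compactin_sets_order_borel)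
      have "emeasure M C \<le> emeasure M (f -` (f ` C) \<inter> space M)"
        by (rule emeasure_mono) (use C measurable_sets[OF fm fCs] in auto)
      also have "\<dots> = emeasure ?D (f ` C)" using fm fCs by (simp add: emeasure_distr)
      also have "\<dots> \<le> ?S" by (rule SUP_upper) (use fC C in auto)
      finally show "emeasure M C \<le> ?S" .
    qed
    finally show "emeasure ?D A \<le> ?S" .
    show "?S \<le> emeasure ?D A"
      by (rule SUP_least) (use A in \<open>auto intro: emeasure_mono\<close>)
  qed
  then show ?thesis
    unfolding radon_on_def using finite_measure_distr[OF fm] by simp
qed

lemma associated_pushforward:
  assumes F: "associated K F M N" and f: "continuous_map (order_top K) (order_top L) f"
  shows "associated L (\<lambda>t. measure M {x\<in>K. f x \<le> t} - measure N {x\<in>K. f x \<le> t})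
    (distr M (order_borel L) f) (distr N (order_borel L) f)"
proof -
  have M: "radon_on K M" and N: "radon_on K N" using F by (auto simp: associated_def)
  have "f x \<in> L" if "x \<in> K" for x using that continuous_map_image_subset_topspace[OF f] by auto
  then have eq: "f -` {s \<in> L. s \<le> t} \<inter> K = {x\<in>K. f x \<le> t}" for t by auto
  have "measure (distr R (order_borel L) f) {s \<in> L. s \<le> t} = measure R {x\<in>K. f x \<le> t}"
    if R: "radon_on K R" and t: "t \<in> L" for R t
  proof -
    have "f \<in> measurable R (order_borel L)"
      using measurable_order_borel[OF f] measurable_cong_sets radon_on_sets[OF R] by blast
    moreover have "{s \<in> L. s \<le> t} \<in> sets (order_borel L)"
      by (simp add: closedin_sets_order_borel closedin_order_top_atMost t)
    ultimately show ?thesis by (subst measure_distr) (simp_all add: radon_on_space[OF R] eq del: vimage_Collect_eq)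
  qed
  then show ?thesis
    unfolding associated_def using radon_on_distr[OF M f] radon_on_distr[OF N f] M N by auto
qed

lemma pairing_distr:
  assumes F: "associated K F M N" and f: "continuous_map (order_top K) (order_top L) f"
    and g: "continuous_map (order_top L) euclideanreal g"
  shows "pairing (distr M (order_borel L) f) (distr N (order_borel L) f) g = pairing M N (g \<circ> f)"
proof -
  have M: "radon_on K M" and N: "radon_on K N" using F by (auto simp: associated_def)
  have m: "f \<in> measurable R (order_borel L)" if "radon_on K R" for R
    using measurable_order_borel[OF f] measurable_cong_sets radon_on_sets[OF that] by blast
  show ?thesis
    unfolding pairing_def comp_def
    using integral_distr[OF m[OF M] borel_measurable_order_borel[OF g]]
      integral_distr[OF m[OF N] borel_measurable_order_borel[OF g]] by simp
qed

text \<open>The mass of a fibre is the mass of a point under the push-forward, and a finite measure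
  charges only countably many points.\<close>

lemma countable_charged_fibres:
  assumes M: "radon_on K M" and f: "continuous_map (order_top K) (order_top L) f"
  shows "countable {t\<in>L. measure M {x\<in>K. f x = t} \<noteq> 0}"
proof -
  interpret finite_measure M using radon_on_finite[OF M] .
  have fm: "f \<in> measurable M (order_borel L)"
    using measurable_order_borel[OF f] measurable_cong_sets radon_on_sets[OF M] by blast
  have eq: "f -` {t} \<inter> K = {x\<in>K. f x = t}" for t by auto
  have "measure (distr M (order_borel L) f) {t} = measure M {x\<in>K. f x = t}" if "t \<in> L" for t
  proof -
    have "{t} \<in> sets (order_borel L)"
      using that by (intro compactin_sets_order_borel) simp
    then show ?thesis using fm by (simp add: measure_distr radon_on_space[OF M] eq)
  qed
  then have "{t\<in>L. measure M {x\<in>K. f x = t} \<noteq> 0} \<subseteq> {t. measure (distr M (order_borel L) f) {t} \<noteq> 0}"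
    by auto
  then show ?thesis
    using finite_measure.countable_support[OF finite_measure_distr[OF fm]] countable_subset by blast
qed

section \<open>Uniform boundedness on spaces of continuous functions\<close>

lemma c0_lim_mono:
  assumes "c0_lim I a" "\<And>i. i \<in> I \<Longrightarrow> \<bar>b i\<bar> \<le> \<bar>a i\<bar>"
  shows "c0_lim I b"
  unfolding c0_lim_def
proof (intro allI impI)
  fix e :: real assume "0 < e"
  then have "finite {i\<in>I. \<bar>a i\<bar> \<ge> e}" using assms(1) by (simp add: c0_lim_def)
  then show "finite {i\<in>I. \<bar>b i\<bar> \<ge> e}"
    by (rule rev_finite_subset) (use assms(2) in force)
qed

lemma c0_lim_cong: "(\<And>i. i \<in> I \<Longrightarrow> a i = b i) \<Longrightarrow> c0_lim I a \<longleftrightarrow> c0_lim I b"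
  using c0_lim_mono[of I a b] c0_lim_mono[of I b a] by auto

text \<open>Each index may choose which of the two null families dominates it; this suits families
  defined by cases.\<close>

lemma c0_lim_combine:
  assumes "c0_lim I a" "c0_lim I b" "\<And>i. i \<in> I \<Longrightarrow> \<bar>c i\<bar> \<le> \<bar>a i\<bar> \<or> \<bar>c i\<bar> \<le> \<bar>b i\<bar>"
  shows "c0_lim I c"
  unfolding c0_lim_def
proof (intro allI impI)
  fix e :: real assume "0 < e"
  then have "finite ({i\<in>I. \<bar>a i\<bar> \<ge> e} \<union> {i\<in>I. \<bar>b i\<bar> \<ge> e})"
    using assms(1,2) by (simp add: c0_lim_def)
  then show "finite {i\<in>I. \<bar>c i\<bar> \<ge> e}"
    by (rule rev_finite_subset) (use assms(3) in force)
qed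

lemma c0_lim_finite_support: "finite {i\<in>I. a i \<noteq> 0} \<Longrightarrow> c0_lim I a"
  unfolding c0_lim_def by (auto elim!: rev_finite_subset)

lemma c0_lim_bounded:
  assumes "c0_lim I a" shows "\<exists>C. \<forall>i\<in>I. \<bar>a i\<bar> \<le> C"
proof -
  have fin: "finite {i\<in>I. \<bar>a i\<bar> \<ge> 1}" using assms by (simp add: c0_lim_def)
  have "\<bar>a i\<bar> \<le> 1 + (\<Sum>j\<in>{i\<in>I. \<bar>a i\<bar> \<ge> 1}. \<bar>a j\<bar>)" if "i \<in> I" for i
  proof (cases "\<bar>a i\<bar> \<ge> 1")
    case True
    then have "\<bar>a i\<bar> \<le> (\<Sum>j\<in>{i\<in>I. \<bar>a i\<bar> \<ge> 1}. \<bar>a j\<bar>)"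
      using fin that by (intro member_le_sum) auto
    then show ?thesis by simp
  next
    case False
    moreover have "0 \<le> (\<Sum>j\<in>{i\<in>I. \<bar>a i\<bar> \<ge> 1}. \<bar>a j\<bar>)" by (rule sum_nonneg) simp
    ultimately show ?thesis by linarith
  qed
  then show ?thesis by blast
qed

lemma countable_nonzero_if_levels:
  fixes a :: "'i \<Rightarrow> real"
  assumes "\<And>e. 0 < e \<Longrightarrow> countable {i\<in>I. \<bar>a i\<bar> \<ge> e}"
  shows "countable {i\<in>I. a i \<noteq> 0}"
proof -
  have "{i\<in>I. a i \<noteq> 0} \<subseteq> (\<Union>n. {i\<in>I. \<bar>a i\<bar> \<ge> inverse (real (Suc n))})"
  proof
    fix i assume "i \<in> {i\<in>I. a i \<noteq> 0}"
    moreover from this obtain n where "inverse (real (Suc n)) < \<bar>a i\<bar>"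
      using reals_Archimedean[of "\<bar>a i\<bar>"] by auto
    ultimately show "i \<in> (\<Union>n. {i\<in>I. \<bar>a i\<bar> \<ge> inverse (real (Suc n))})" by (auto intro: less_imp_le)
  qed
  moreover have "countable (\<Union>n. {i\<in>I. \<bar>a i\<bar> \<ge> inverse (real (Suc n))})"
    by (intro countable_UN assms) auto
  ultimately show ?thesis by (rule countable_subset)
qed

lemma c0_lim_countable_nonzero: "c0_lim I a \<Longrightarrow> countable {i\<in>I. a i \<noteq> 0}"
  by (rule countable_nonzero_if_levels) (simp add: c0_lim_def countable_finite)

text \<open>The gliding hump argument of Sokal: each functional is tested on the partial sums of a
  series of functions whose signs are chosen so that no cancellation occurs.\<close>

lemma uniform_boundedness_continuous:
  fixes T :: "'i \<Rightarrow> ('a \<Rightarrow> real) \<Rightarrow> real" and X :: "'a topology"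
  assumes lin: "\<And>i f g c. \<lbrakk>i \<in> I; continuous_map X euclideanreal f; continuous_map X euclideanreal g\<rbrakk>
      \<Longrightarrow> T i (\<lambda>x. f x + c * g x) = T i f + c * T i g"
    and bnd: "\<And>i f. \<lbrakk>i \<in> I; continuous_map X euclideanreal f; \<forall>x\<in>topspace X. \<bar>f x\<bar> \<le> 1\<rbrakk>
      \<Longrightarrow> \<bar>T i f\<bar> \<le> B i"
    and pw: "\<And>f. continuous_map X euclideanreal f \<Longrightarrow> \<exists>C. \<forall>i\<in>I. \<bar>T i f\<bar> \<le> C"
  shows "\<exists>C. \<forall>i\<in>I. \<forall>f. continuous_map X euclideanreal f \<and> (\<forall>x\<in>topspace X. \<bar>f x\<bar> \<le> 1) \<longrightarrow> \<bar>T i f\<bar> \<le> C"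
proof (rule ccontr)
  define ball where "ball = {f. continuous_map X euclideanreal f \<and> (\<forall>x\<in>topspace X. \<bar>f x\<bar> \<le> 1)}"
  assume "\<not> ?thesis"
  then have unb: "\<exists>i\<in>I. \<exists>f\<in>ball. \<bar>T i f\<bar> > C" for C
    unfolding ball_def by (auto simp: not_le)
  \<comment> \<open>The dual norm of the \<open>i\<close>-th functional; \<open>bnd\<close> makes
    the supremum finite.\<close>
  define N where "N i = (SUP f\<in>ball. \<bar>T i f\<bar>)" for i
  have bdd: "bdd_above ((\<lambda>f. \<bar>T i f\<bar>) ` ball)" if "i \<in> I" for i
    using bnd[OF that] by (auto simp: ball_def bdd_above_def)
  have zero_ball: "(\<lambda>x. 0) \<in> ball" by (simp add: ball_def)
  have N_upper: "\<bar>T i f\<bar> \<le> N i" if "i \<in> I" "f \<in> ball" for i f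
    unfolding N_def by (rule cSUP_upper[OF that(2) bdd[OF that(1)]])
  have T0: "T i (\<lambda>x. 0) = 0" if "i \<in> I" for i
    using lin[OF that, of "\<lambda>x. 0" "\<lambda>x. 0" 1] by simp
  have N_scale: "\<bar>T i h\<bar> \<le> N i * c"
    if h: "i \<in> I" "continuous_map X euclideanreal h" "\<And>x. x \<in> topspace X \<Longrightarrow> \<bar>h x\<bar> \<le> c" "0 < c" for i h c
  proof -
    let ?g = "\<lambda>x. h x * inverse c"
    have g: "continuous_map X euclideanreal ?g" using h(2) by (intro continuous_intros) auto
    have "\<bar>h x\<bar> * inverse c \<le> 1" if "x \<in> topspace X" for x
      using h(3)[OF that] h(4) by (simp add: field_simps)
    then have "?g \<in> ball" using g h(4) by (simp add: ball_def abs_mult)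
    then have "\<bar>T i ?g\<bar> \<le> N i" using N_upper h(1) by simp
    moreover have "T i (\<lambda>x. 0 + c * ?g x) = T i (\<lambda>x. 0) + c * T i ?g"
      by (rule lin[OF h(1) _ g]) simp
    moreover have "(\<lambda>x. 0 + c * ?g x) = h" using h(4) by (auto simp: field_simps)
    ultimately have "\<bar>T i h\<bar> = c * \<bar>T i ?g\<bar>" using T0[OF h(1)] h(4) by (simp add: abs_mult)
    then show ?thesis using \<open>\<bar>T i ?g\<bar> \<le> N i\<close> h(4) by (simp add: mult.commute)
  qed
  \<comment> \<open>The weights \<open>(1/3)^n\<close> used below leave a factor
    \<open>(1/3)^n * 4^n\<close>, which is unbounded. The ratio 2/3 has to exceed the 1/2 lost to
    the tail after step \<open>n\<close>.\<close>
  have "\<exists>j f. j \<in> I \<and> f \<in> ball \<and> N j \<ge> 4^n \<and> \<bar>T j f\<bar> \<ge> 2/3 * N j" for n :: nat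
  proof -
    obtain j f0 where j: "j \<in> I" "f0 \<in> ball" "\<bar>T j f0\<bar> > 4^n" using unb by blast
    then have Nj: "N j \<ge> 4^n" using N_upper by fastforce
    moreover have "0 < (4::real)^n" by simp
    ultimately have "2/3 * N j < N j" by linarith
    then obtain f where "f \<in> ball" "2/3 * N j < \<bar>T j f\<bar>"
      unfolding N_def using less_cSUP_iff[OF _ bdd[OF j(1)]] zero_ball by blast
    then show ?thesis using j Nj by (intro exI[of _ j] exI[of _ f]) auto
  qed
  then obtain j f where jf: "\<And>n. j n \<in> I" "\<And>n. f n \<in> ball" "\<And>n. N (j n) \<ge> 4^n"
    "\<And>n. \<bar>T (j n) (f n)\<bar> \<ge> 2/3 * N (j n)"
    by metis
  define step where "step n x e = (\<lambda>y. x y + (e * (1/3)^n) * f n y)" for n :: nat and x :: "'a \<Rightarrow> real" and e :: real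
  define P where "P n x \<longleftrightarrow> \<bar>T (j n) x\<bar> \<ge> (1/3)^n * \<bar>T (j n) (f n)\<bar>" for n x
  define x where "x = rec_nat (\<lambda>y. 0) (\<lambda>n x. if P n (step n x 1) then step n x 1 else step n x (-1))"
  have x0: "x 0 = (\<lambda>y. 0)" by (simp add: x_def)
  have xS: "x (Suc n) = (if P n (step n (x n) 1) then step n (x n) 1 else step n (x n) (-1))" for n
    by (simp add: x_def)
  have fc: "continuous_map X euclideanreal (f n)" for n using jf(2)[of n] by (simp add: ball_def)
  have stepc: "continuous_map X euclideanreal (step n h e)" if "continuous_map X euclideanreal h" for n h e
    unfolding step_def using fc that by (intro continuous_intros) auto
  have xc: "continuous_map X euclideanreal (x n)" for n
    by (induction n) (auto simp: x0 xS stepc)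
  \<comment> \<open>The values at the two candidates differ by \<open>2 * ?b\<close>, so at least
    one of them has absolute value at least \<open>\<bar>?b\<bar>\<close>.\<close>
  have PS: "P n (x (Suc n))" for n
  proof (cases "P n (step n (x n) 1)")
    case False
    let ?b = "(1/3)^n * T (j n) (f n)"
    have Tstep: "T (j n) (step n (x n) e) = T (j n) (x n) + (e * (1/3)^n) * T (j n) (f n)" for e
      unfolding step_def by (rule lin[OF jf(1) xc fc])
    have "\<bar>?b\<bar> = (1/3)^n * \<bar>T (j n) (f n)\<bar>" by (simp add: abs_mult)
    moreover have "T (j n) (step n (x n) 1) = T (j n) (x n) + ?b"
      "T (j n) (step n (x n) (-1)) = T (j n) (x n) - ?b"
      using Tstep[of 1] Tstep[of "-1"] by simp_all
    ultimately have "P n (step n (x n) (-1))" using False unfolding P_def by linarith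
    then show ?thesis using False by (simp add: xS)
  qed (simp add: xS)
  have xdiff: "\<bar>x (Suc n) y - x n y\<bar> \<le> (1/3)^n" if "y \<in> topspace X" for n y
  proof -
    have "\<bar>x (Suc n) y - x n y\<bar> = (1/3)^n * \<bar>f n y\<bar>" by (auto simp: xS step_def abs_mult)
    also have "\<dots> \<le> (1/3)^n * 1" using jf(2)[of n] that by (intro mult_left_mono) (auto simp: ball_def)
    finally show ?thesis by simp
  qed
  \<comment> \<open>The closed form of the geometric sum is what the induction can carry; the bound
    without the last factor would not reproduce itself.\<close>
  have xtail: "\<bar>x (n + m) y - x n y\<bar> \<le> 3/2 * (1/3)^n * (1 - (1/3)^m)" if y: "y \<in> topspace X" for n m y
  proof (induction m)
    case (Suc m)
    have "\<bar>x (n + Suc m) y - x n y\<bar> \<le> \<bar>x (n + m) y - x n y\<bar> + (1/3)^(n+m)"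
      using xdiff[OF y, of "n+m"] by simp
    also have "\<dots> \<le> 3/2 * (1/3)^n * (1 - (1/3)^m) + (1/3)^(n+m)" using Suc by simp
    also have "\<dots> = 3/2 * (1/3)^n * (1 - (1/3)^Suc m)" by (simp add: power_add field_simps)
    finally show ?case .
  qed simp
  have xtail': "\<bar>x (n + m) y - x n y\<bar> \<le> 3/2 * (1/3)^n" if y: "y \<in> topspace X" for n m y
  proof -
    have "3/2 * (1/3::real)^n * (1 - (1/3)^m) \<le> 3/2 * (1/3)^n * 1" by (intro mult_left_mono) auto
    then show ?thesis using xtail[OF y, of n m] by linarith
  qed
  have small: "\<exists>n. 3/2 * (1/3::real)^n < e" if "0 < e" for e
    using real_arch_pow_inv[of "2/3 * e" "1/3"] that by (auto simp: field_simps)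
  have conv: "convergent (\<lambda>n. x n y)" if y: "y \<in> topspace X" for y
  proof -
    have "Cauchy (\<lambda>n. x n y)"
    proof (rule metric_CauchyI)
      fix e :: real assume "0 < e"
      then obtain n where n: "3/2 * (1/3::real)^n < e/2" using small[of "e/2"] by auto
      have "\<bar>x p y - x n y\<bar> < e/2" if "p \<ge> n" for p
        using xtail'[OF y, of n "p - n"] that n by simp
      then have "dist (x p y) (x q y) < e" if "p \<ge> n" "q \<ge> n" for p q
        using that unfolding dist_real_def by (smt (verit) field_sum_of_halves)
      then show "\<exists>M. \<forall>m\<ge>M. \<forall>n\<ge>M. dist (x m y) (x n y) < e" by blast
    qed
    then show ?thesis by (simp add: Cauchy_convergent)
  qed
  define g where "g y = lim (\<lambda>n. x n y)" for y
  have glim: "(\<lambda>n. x n y) \<longlonglongrightarrow> g y" if "y \<in> topspace X" for y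
    unfolding g_def using conv[OF that] by (simp add: convergent_LIMSEQ_iff)
  have gtail: "\<bar>g y - x n y\<bar> \<le> 3/2 * (1/3)^n" if y: "y \<in> topspace X" for n y
  proof (rule tendsto_upperbound)
    show "(\<lambda>m. \<bar>x (m + n) y - x n y\<bar>) \<longlonglongrightarrow> \<bar>g y - x n y\<bar>"
      by (intro tendsto_intros LIMSEQ_ignore_initial_segment glim y)
    show "\<forall>\<^sub>F m in sequentially. \<bar>x (m + n) y - x n y\<bar> \<le> 3/2 * (1/3)^n"
      using xtail'[OF y, of n] by (simp add: add.commute)
  qed simp
  have gc: "continuous_map X euclideanreal g"
  proof -
    have "continuous_map X Met_TC.mtopology g"
    proof (rule Met_TC.continuous_map_uniform_limit[where f = x and F = sequentially])
      show "\<forall>\<^sub>F n in sequentially. continuous_map X Met_TC.mtopology (x n)" using xc by simp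
      fix e :: real assume "0 < e"
      then obtain n where n: "3/2 * (1/3::real)^n < e" using small by auto
      have "\<forall>y\<in>topspace X. g y \<in> UNIV \<and> dist (x m y) (g y) < e" if "m \<ge> n" for m
      proof -
        have "3/2 * (1/3::real)^m \<le> 3/2 * (1/3)^n"
          using that by (intro mult_left_mono power_decreasing) auto
        then have "\<bar>g y - x m y\<bar> < e" if "y \<in> topspace X" for y
          using gtail[OF that, of m] n by linarith
        then show ?thesis by (simp add: dist_real_def abs_minus_commute)
      qed
      then show "\<forall>\<^sub>F m in sequentially. \<forall>y\<in>topspace X. g y \<in> UNIV \<and> dist (x m y) (g y) < e"
        using eventually_sequentially by blast
    qed simp
    then show ?thesis by simp
  qed
  obtain C where C: "\<And>i. i \<in> I \<Longrightarrow> \<bar>T i g\<bar> \<le> C" using pw[OF gc] by blast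
  \<comment> \<open>The steps after the \<open>n\<close>-th change the limit by at most
    \<open>3/2 * (1/3)^Suc n = 1/2 * (1/3)^n\<close>, and \<open>2/3 - 1/2 = 1/6\<close>.\<close>
  have lower: "1/6 * (4/3)^n \<le> \<bar>T (j n) g\<bar>" for n
  proof -
    let ?h = "\<lambda>y. g y + (-1) * x (Suc n) y"
    have hc: "continuous_map X euclideanreal ?h" using gc xc by (intro continuous_intros) auto
    have hb: "\<bar>?h y\<bar> \<le> 1/2 * (1/3)^n" if "y \<in> topspace X" for y
      using gtail[OF that, of "Suc n"] by simp
    have "\<bar>T (j n) ?h\<bar> \<le> N (j n) * (1/2 * (1/3)^n)"
      by (rule N_scale[OF jf(1) hc hb]) auto
    moreover have "T (j n) ?h = T (j n) g + (-1) * T (j n) (x (Suc n))"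
      by (rule lin[OF jf(1) gc xc])
    moreover have "(1/3)^n * (2/3 * N (j n)) \<le> (1/3)^n * \<bar>T (j n) (f n)\<bar>"
      by (intro mult_left_mono jf(4)) auto
    then have "(1/3)^n * (2/3 * N (j n)) \<le> \<bar>T (j n) (x (Suc n))\<bar>"
      using PS[of n] unfolding P_def by linarith
    ultimately have "(1/3)^n * (2/3 * N (j n)) - N (j n) * (1/2 * (1/3)^n) \<le> \<bar>T (j n) g\<bar>"
      by linarith
    then have "1/6 * ((1/3)^n * N (j n)) \<le> \<bar>T (j n) g\<bar>" by (simp add: algebra_simps)
    moreover have "(1/3)^n * 4^n \<le> (1/3)^n * N (j n)" by (intro mult_left_mono jf(3)) auto
    moreover have "(1/3)^n * 4^n = (4/3::real)^n" by (simp add: power_mult_distrib[symmetric])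
    ultimately show ?thesis by linarith
  qed
  obtain n where "6 * C < (4/3::real)^n" using real_arch_pow[of "4/3"] by auto
  then show False using lower[of n] C[OF jf(1)[of n]] by linarith
qed

section \<open>Weak*-null families\<close>

locale null_family =
  fixes K :: "'a::linorder set" and I :: "'i set" and F :: "'i \<Rightarrow> 'a \<Rightarrow> real"
    and M N :: "'i \<Rightarrow> 'a measure"
  assumes K: "compact_line K"
    and assoc: "i \<in> I \<Longrightarrow> associated K (F i) (M i) (N i)"
    and null: "continuous_map (order_top K) euclideanreal f \<Longrightarrow> c0_lim I (\<lambda>i. pairing (M i) (N i) f)"
begin

lemma radon: assumes "i \<in> I" shows "radon_on K (M i)" "radon_on K (N i)"
  using assoc[OF assms] by (auto simp: associated_def)

lemma F_eq: "\<lbrakk>i \<in> I; t \<in> K\<rbrakk> \<Longrightarrow> F i t = measure (M i) {s\<in>K. s \<le> t} - measure (N i) {s\<in>K. s \<le> t}"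
  using assoc by (auto simp: associated_def)

lemma pairing_lincomb:
  assumes i: "i \<in> I" and f: "continuous_map (order_top K) euclideanreal f"
    and g: "continuous_map (order_top K) euclideanreal g"
  shows "pairing (M i) (N i) (\<lambda>x. f x + c * g x) = pairing (M i) (N i) f + c * pairing (M i) (N i) g"
  using radon_on_integrable[OF K radon(1)[OF i] f] radon_on_integrable[OF K radon(1)[OF i] g]
    radon_on_integrable[OF K radon(2)[OF i] f] radon_on_integrable[OF K radon(2)[OF i] g]
  by (simp add: pairing_def algebra_simps)

lemma pairing_sum:
  assumes i: "i \<in> I" and "finite S" and d: "\<And>s. s \<in> S \<Longrightarrow> continuous_map (order_top K) euclideanreal (d s)"
  shows "pairing (M i) (N i) (\<lambda>x. \<Sum>s\<in>S. e s * d s x) = (\<Sum>s\<in>S. e s * pairing (M i) (N i) (d s))"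
  using assms(2,3)
proof (induction S)
  case empty
  then show ?case by (simp add: pairing_def)
next
  case (insert s S)
  have "continuous_map (order_top K) euclideanreal (\<lambda>x. \<Sum>s\<in>S. e s * d s x)"
    using insert by (intro continuous_intros) auto
  from pairing_lincomb[OF i this insert.prems[of s], of "e s"] insert
  show ?case by (simp add: add.commute)
qed

text \<open>The individual bound \<open>measure (M i) K + measure (N i) K\<close> need not be
  uniform in \<open>i\<close>. It feeds the uniform boundedness principle, whose pointwise
  hypothesis holds because null families are bounded.\<close>

lemma pairing_bounded:
  "\<exists>C. \<forall>i\<in>I. \<forall>f. continuous_map (order_top K) euclideanreal f \<and> (\<forall>x\<in>K. \<bar>f x\<bar> \<le> 1)
    \<longrightarrow> \<bar>pairing (M i) (N i) f\<bar> \<le> C"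
proof -
  have integral_le: "\<bar>integral\<^sup>L R f\<bar> \<le> measure R K"
    if R: "radon_on K R" and f: "continuous_map (order_top K) euclideanreal f" "\<forall>x\<in>K. \<bar>f x\<bar> \<le> 1" for R f
  proof -
    interpret finite_measure R using radon_on_finite[OF R] .
    have "\<bar>integral\<^sup>L R f\<bar> \<le> integral\<^sup>L R (\<lambda>x. \<bar>f x\<bar>)" by (rule integral_abs_bound)
    also have "\<dots> \<le> integral\<^sup>L R (\<lambda>x. 1)"
      by (rule integral_mono)
        (use radon_on_integrable[OF K R f(1)] f(2) radon_on_space[OF R] in auto)
    finally show ?thesis by (simp add: radon_on_space[OF R])
  qed
  have "\<exists>C. \<forall>i\<in>I. \<forall>f. continuous_map (order_top K) euclideanreal f \<and> (\<forall>x\<in>topspace (order_top K). \<bar>f x\<bar> \<le> 1)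
    \<longrightarrow> \<bar>pairing (M i) (N i) f\<bar> \<le> C"
  proof (rule uniform_boundedness_continuous[OF pairing_lincomb])
    fix i f assume f: "i \<in> I" "continuous_map (order_top K) euclideanreal f" "\<forall>x\<in>topspace (order_top K). \<bar>f x\<bar> \<le> 1"
    then show "\<bar>pairing (M i) (N i) f\<bar> \<le> measure (M i) K + measure (N i) K"
      using integral_le[OF radon(1)[OF f(1)] f(2)] integral_le[OF radon(2)[OF f(1)] f(2)]
      by (simp add: pairing_def)
  qed (use null c0_lim_bounded in auto)
  then show ?thesis by simp
qed

text \<open>The bump \<open>h\<close> may depend on \<open>i\<close>. Admitting every
  \<open>g\<close> below it that equals 1 up to \<open>s\<close> makes it possible to cut
  \<open>h\<close> down by a second bump without losing the approximation. At the maximum of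
  \<open>K\<close> there is no gap, and the constant 1 gives the exact value.\<close>

lemma F_approx:
  assumes i: "i \<in> I" and s: "s \<in> K" and e: "0 < e"
  obtains h where "continuous_map (order_top K) euclideanreal h" "\<And>x. x \<in> K \<Longrightarrow> 0 \<le> h x \<and> h x \<le> 1"
    "\<And>x. \<lbrakk>x \<in> K; x \<le> s\<rbrakk> \<Longrightarrow> h x = 1"
    "\<forall>g. continuous_map (order_top K) euclideanreal g \<and> (\<forall>x\<in>K. 0 \<le> g x \<and> g x \<le> h x) \<and>
      (\<forall>x\<in>K. x \<le> s \<longrightarrow> g x = 1) \<longrightarrow> \<bar>pairing (M i) (N i) g - F i s\<bar> < e"
proof (cases "\<exists>y\<in>K. s < y")
  case True
  then obtain y where y: "y \<in> K" "s < y" by auto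
  obtain u where u: "u \<in> K" "s < u"
    "measure (M i) {x\<in>K. s < x \<and> x < u} + measure (N i) {x\<in>K. s < x \<and> x < u} < e"
    using associated_small_gap[OF assoc[OF i] s y e] by blast
  obtain h where h: "continuous_map (order_top K) euclideanreal h" "\<And>x. x \<in> K \<Longrightarrow> 0 \<le> h x \<and> h x \<le> 1"
    "\<And>x. \<lbrakk>x \<in> K; x \<le> s\<rbrakk> \<Longrightarrow> h x = 1" "\<And>x. \<lbrakk>x \<in> K; u \<le> x\<rbrakk> \<Longrightarrow> h x = 0"
    using order_top_Urysohn[OF K s u(1,2)] by blast
  show ?thesis
  proof (rule that[OF h(1-3)]; (intro allI impI)?)
    fix g assume g: "continuous_map (order_top K) euclideanreal g \<and> (\<forall>x\<in>K. 0 \<le> g x \<and> g x \<le> h x) \<and>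
      (\<forall>x\<in>K. x \<le> s \<longrightarrow> g x = 1)"
    have "\<bar>pairing (M i) (N i) g - F i s\<bar>
        \<le> measure (M i) {x\<in>K. s < x \<and> x < u} + measure (N i) {x\<in>K. s < x \<and> x < u}"
    proof (rule pairing_gap[OF assoc[OF i] s u(1)])
      show "continuous_map (order_top K) euclideanreal g" using g by simp
      show "0 \<le> g x \<and> g x \<le> 1" if "x \<in> K" for x using g h(2)[OF that] that by force
      show "g x = 1" if "x \<in> K" "x \<le> s" for x using g that by simp
      show "g x = 0" if "x \<in> K" "u \<le> x" for x using g h(4)[OF that] that by force
    qed
    then show "\<bar>pairing (M i) (N i) g - F i s\<bar> < e" using u(3) by linarith
  qed auto
next
  case False
  then have top: "{x\<in>K. x \<le> s} = K" "\<And>x. x \<in> K \<Longrightarrow> x \<le> s" by (auto simp: not_less)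
  show ?thesis
  proof (rule that[of "\<lambda>x. 1"]; (intro allI impI)?)
    fix g :: "'a \<Rightarrow> real" assume "continuous_map (order_top K) euclideanreal g \<and>
      (\<forall>x\<in>K. 0 \<le> g x \<and> g x \<le> 1) \<and> (\<forall>x\<in>K. x \<le> s \<longrightarrow> g x = 1)"
    then have g: "\<And>x. x \<in> K \<Longrightarrow> g x = 1" using top by auto
    have "integral\<^sup>L R g = measure R K" if R: "radon_on K R" for R
    proof -
      have "integral\<^sup>L R g = integral\<^sup>L R (\<lambda>x. 1)"
        by (rule Bochner_Integration.integral_cong) (use g radon_on_space[OF R] in auto)
      then show ?thesis using radon_on_space[OF R] by simp
    qed
    then have "pairing (M i) (N i) g = F i s"
      using radon[OF i] by (simp add: pairing_def F_eq[OF i s] top(1))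
    then show "\<bar>pairing (M i) (N i) g - F i s\<bar> < e" using e by simp
  qed auto
qed

text \<open>For a level \<open>e\<close>, choose \<open>u i\<close> above \<open>s\<close> so that
  the gap carries little mass of \<open>M i\<close> and \<open>N i\<close>. A single Urysohn
  function descending between \<open>s\<close> and \<open>v\<close> then detects every index of the
  level with \<open>v \<le> u i\<close>, so there are only finitely many of these. At the maximum of
  \<open>K\<close> the value is the integral of 1.\<close>

lemma countable_F_nonzero:
  assumes s: "s \<in> K" shows "countable {i\<in>I. F i s \<noteq> 0}"
proof (cases "\<exists>y\<in>K. s < y")
  case False
  then have top: "\<And>x. x \<in> K \<Longrightarrow> x \<le> s" by (auto simp: not_less)
  have "F i s = pairing (M i) (N i) (\<lambda>x. 1)" if i: "i \<in> I" for i
  proof -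
    have "{x\<in>K. x \<le> s} = K" using top by auto
    then show ?thesis
      using radon_on_space[OF radon(1)[OF i]] radon_on_space[OF radon(2)[OF i]]
      by (simp add: pairing_def F_eq[OF i s])
  qed
  then have "c0_lim I (\<lambda>i. F i s) \<longleftrightarrow> c0_lim I (\<lambda>i. pairing (M i) (N i) (\<lambda>x. 1))"
    by (rule c0_lim_cong)
  then have "c0_lim I (\<lambda>i. F i s)" using null[of "\<lambda>x. 1"] by simp
  then show ?thesis by (rule c0_lim_countable_nonzero)
next
  case True
  then obtain y where y: "y \<in> K" "s < y" by auto
  show ?thesis
  proof (rule countable_nonzero_if_levels)
    fix e :: real assume e: "0 < e"
    let ?J = "{i\<in>I. \<bar>F i s\<bar> \<ge> e}"
    have "\<forall>i\<in>I. \<exists>u. u \<in> K \<and> s < u \<and>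
        measure (M i) {x\<in>K. s < x \<and> x < u} + measure (N i) {x\<in>K. s < x \<and> x < u} < e/2"
    proof
      fix i assume "i \<in> I"
      from associated_small_gap[OF assoc[OF this] s y half_gt_zero[OF e]]
      show "\<exists>u. u \<in> K \<and> s < u \<and>
        measure (M i) {x\<in>K. s < x \<and> x < u} + measure (N i) {x\<in>K. s < x \<and> x < u} < e/2" by blast
    qed
    from bchoice[OF this] obtain u where u: "\<And>i. i \<in> I \<Longrightarrow> u i \<in> K" "\<And>i. i \<in> I \<Longrightarrow> s < u i"
      "\<And>i. i \<in> I \<Longrightarrow> measure (M i) {x\<in>K. s < x \<and> x < u i} + measure (N i) {x\<in>K. s < x \<and> x < u i} < e/2"
      by blast
    have fin: "finite {i\<in>?J. v \<le> u i}" if v: "v \<in> K" "s < v" for v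
    proof -
      obtain g where g: "continuous_map (order_top K) euclideanreal g" "\<And>x. x \<in> K \<Longrightarrow> 0 \<le> g x \<and> g x \<le> 1"
        "\<And>x. \<lbrakk>x \<in> K; x \<le> s\<rbrakk> \<Longrightarrow> g x = 1" "\<And>x. \<lbrakk>x \<in> K; v \<le> x\<rbrakk> \<Longrightarrow> g x = 0"
        using order_top_Urysohn[OF K s v] by blast
      have "finite {i\<in>I. \<bar>pairing (M i) (N i) g\<bar> \<ge> e/2}"
        using null[OF g(1)] e unfolding c0_lim_def by (metis half_gt_zero)
      moreover have "{i\<in>?J. v \<le> u i} \<subseteq> {i\<in>I. \<bar>pairing (M i) (N i) g\<bar> \<ge> e/2}"
      proof clarify
        fix i assume i: "i \<in> I" "e \<le> \<bar>F i s\<bar>" "v \<le> u i"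
        have "\<bar>pairing (M i) (N i) g - F i s\<bar>
            \<le> measure (M i) {x\<in>K. s < x \<and> x < u i} + measure (N i) {x\<in>K. s < x \<and> x < u i}"
          by (rule pairing_gap[OF assoc[OF i(1)] s u(1)[OF i(1)] g(1,2,3)]) (use g(4) i(3) in auto)
        then show "e/2 \<le> \<bar>pairing (M i) (N i) g\<bar>" using u(3)[OF i(1)] i(2) by linarith
      qed
      ultimately show ?thesis by (rule rev_finite_subset)
    qed
    show "countable ?J"
    proof (cases "finite ?J")
      case False
      then obtain p :: "nat \<Rightarrow> 'i" where p: "inj p" "range p \<subseteq> ?J"
        using infinite_countable_subset by blast
      \<comment> \<open>Only finitely many \<open>k\<close> satisfy
        \<open>u i \<le> u (p k)\<close>, so the points \<open>u (p k)\<close> get below every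
        \<open>u i\<close>, and countably many finite sets exhaust the level.\<close>
      have "?J \<subseteq> (\<Union>k. {i\<in>?J. u (p k) \<le> u i})"
      proof
        fix i assume i: "i \<in> ?J"
        have "finite (p -` {j\<in>?J. u i \<le> u j})"
          by (rule finite_vimageI[OF fin p(1)]) (use i u in auto)
        from ex_new_if_finite[OF infinite_UNIV_nat this]
        obtain k where "p k \<notin> {j\<in>?J. u i \<le> u j}" by auto
        moreover have "p k \<in> ?J" using p(2) by auto
        ultimately show "i \<in> (\<Union>k. {i\<in>?J. u (p k) \<le> u i})" using i by (auto simp: not_le intro: less_imp_le)
      qed
      moreover have "finite {i\<in>?J. u (p k) \<le> u i}" for k
        by (rule fin) (use p(2) u in auto)
      then have "countable (\<Union>k. {i\<in>?J. u (p k) \<le> u i})" by (simp add: countable_finite)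
      ultimately show ?thesis by (rule countable_subset)
    qed (rule countable_finite)
  qed
qed

text \<open>For each \<open>i\<close> the value \<open>F i s\<close> is close to the integral of a
  bump \<open>h s\<close> adapted to \<open>i\<close>, while the integrals of bumps
  \<open>g s\<close> independent of \<open>i\<close> tend to 0. The differences
  \<open>g s - h s\<close> live in disjoint gaps of \<open>S\<close>, so the absolute values of
  their integrals add up to at most the uniform norm bound.\<close>

lemma ex_cofinite_sum_bound:
  "\<exists>C. \<forall>S. finite S \<and> S \<subseteq> K \<longrightarrow> finite {i\<in>I. \<not> (\<Sum>s\<in>S. \<bar>F i s\<bar>) \<le> C}"
proof -
  obtain C where C: "\<And>i f. \<lbrakk>i \<in> I; continuous_map (order_top K) euclideanreal f; \<forall>x\<in>K. \<bar>f x\<bar> \<le> 1\<rbrakk>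
    \<Longrightarrow> \<bar>pairing (M i) (N i) f\<bar> \<le> C"
    using pairing_bounded by blast
  have "finite {i\<in>I. \<not> (\<Sum>s\<in>S. \<bar>F i s\<bar>) \<le> C + 2}" if S: "finite S" "S \<subseteq> K" for S
  proof -
    have "\<exists>g. continuous_map (order_top K) euclideanreal g \<and> (\<forall>x\<in>K. 0 \<le> g x \<and> g x \<le> 1) \<and>
       (\<forall>x\<in>K. x \<le> s \<longrightarrow> g x = 1) \<and> (\<forall>x\<in>K. \<forall>s'\<in>S. s < s' \<and> s' \<le> x \<longrightarrow> g x = 0)" if s: "s \<in> S" for s
    proof (cases "{s'\<in>S. s < s'} = {}")
      case True
      then show ?thesis by (intro exI[of _ "\<lambda>x. 1"]) auto
    next
      case False
      let ?n = "Min {s'\<in>S. s < s'}"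
      have fin: "finite {s'\<in>S. s < s'}" using S by simp
      have n: "?n \<in> K" "s < ?n" using Min_in[OF fin False] S by auto
      have "s \<in> K" using s S by auto
      obtain g where g: "continuous_map (order_top K) euclideanreal g" "\<And>x. x \<in> K \<Longrightarrow> 0 \<le> g x \<and> g x \<le> 1"
        "\<And>x. \<lbrakk>x \<in> K; x \<le> s\<rbrakk> \<Longrightarrow> g x = 1" "\<And>x. \<lbrakk>x \<in> K; ?n \<le> x\<rbrakk> \<Longrightarrow> g x = 0"
        using order_top_Urysohn[OF K \<open>s \<in> K\<close> n] by blast
      have "?n \<le> x" if "s' \<in> S" "s < s'" "s' \<le> x" for s' x
        using Min_le[OF fin, of s'] that by auto
      then show ?thesis using g by (intro exI[of _ g]) auto
    qed
    from bchoice[OF ballI[OF this]]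
    obtain g where g': "\<forall>s\<in>S. continuous_map (order_top K) euclideanreal (g s) \<and> (\<forall>x\<in>K. 0 \<le> g s x \<and> g s x \<le> 1) \<and>
       (\<forall>x\<in>K. x \<le> s \<longrightarrow> g s x = 1) \<and> (\<forall>x\<in>K. \<forall>s'\<in>S. s < s' \<and> s' \<le> x \<longrightarrow> g s x = 0)" ..
    have g: "\<And>s. s \<in> S \<Longrightarrow> continuous_map (order_top K) euclideanreal (g s)"
      "\<And>s x. \<lbrakk>s \<in> S; x \<in> K\<rbrakk> \<Longrightarrow> 0 \<le> g s x \<and> g s x \<le> 1"
      "\<And>s x. \<lbrakk>s \<in> S; x \<in> K; x \<le> s\<rbrakk> \<Longrightarrow> g s x = 1"
      "\<And>s x s'. \<lbrakk>s \<in> S; x \<in> K; s' \<in> S; s < s'; s' \<le> x\<rbrakk> \<Longrightarrow> g s x = 0"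
      using g' by simp_all blast
    \<comment> \<open>Two errors of size \<open>e\<close> per point add up to at most 2, whence
      \<open>C + 2\<close>; the added 1 covers empty \<open>S\<close>.\<close>
    define e where "e = 1 / (real (card S) + 1)"
    have e: "0 < e" "real (card S) * e \<le> 1" by (auto simp: e_def field_simps)
    have fin: "finite (\<Union>s\<in>S. {i\<in>I. \<bar>pairing (M i) (N i) (g s)\<bar> \<ge> e})"
      using S(1) null g(1) e(1) by (auto simp: c0_lim_def)
    have "(\<Sum>s\<in>S. \<bar>F i s\<bar>) \<le> C + 2" if i: "i \<in> I" "\<And>s. s \<in> S \<Longrightarrow> \<bar>pairing (M i) (N i) (g s)\<bar> < e" for i
    proof -
      have "\<exists>h. continuous_map (order_top K) euclideanreal h \<and> (\<forall>x\<in>K. 0 \<le> h x \<and> h x \<le> g s x) \<and>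
        (\<forall>x\<in>K. x \<le> s \<longrightarrow> h x = 1) \<and> \<bar>pairing (M i) (N i) h - F i s\<bar> < e" if s: "s \<in> S" for s
      proof -
        have "s \<in> K" using s S by auto
        obtain h where h: "continuous_map (order_top K) euclideanreal h" "\<And>x. x \<in> K \<Longrightarrow> 0 \<le> h x \<and> h x \<le> 1"
          "\<And>x. \<lbrakk>x \<in> K; x \<le> s\<rbrakk> \<Longrightarrow> h x = 1"
          "\<forall>g. continuous_map (order_top K) euclideanreal g \<and> (\<forall>x\<in>K. 0 \<le> g x \<and> g x \<le> h x) \<and>
            (\<forall>x\<in>K. x \<le> s \<longrightarrow> g x = 1) \<longrightarrow> \<bar>pairing (M i) (N i) g - F i s\<bar> < e"
          using F_approx[OF i(1) \<open>s \<in> K\<close> e(1)] by blast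
        \<comment> \<open>Cutting by \<open>g s\<close> makes the difference nonnegative and forces
          it to vanish from the next point of \<open>S\<close> on.\<close>
        let ?h = "\<lambda>x. min (h x) (g s x)"
        have hc: "continuous_map (order_top K) euclideanreal ?h"
          using h(1) g(1)[OF s] by (intro continuous_intros)
        have h01: "0 \<le> ?h x \<and> ?h x \<le> h x" if "x \<in> K" for x using h(2) g(2)[OF s] that by auto
        have h1: "?h x = 1" if "x \<in> K" "x \<le> s" for x using h(3) g(3)[OF s] that by auto
        have "\<bar>pairing (M i) (N i) ?h - F i s\<bar> < e"
          using h(4)[rule_format, of ?h] hc h01 h1 by blast
        then show ?thesis using hc h01 h1 by (intro exI[of _ ?h]) auto
      qed
      from bchoice[OF ballI[OF this]]
      obtain h where h': "\<forall>s\<in>S. continuous_map (order_top K) euclideanreal (h s) \<and> (\<forall>x\<in>K. 0 \<le> h s x \<and> h s x \<le> g s x) \<and>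
        (\<forall>x\<in>K. x \<le> s \<longrightarrow> h s x = 1) \<and> \<bar>pairing (M i) (N i) (h s) - F i s\<bar> < e" ..
      have h: "\<And>s. s \<in> S \<Longrightarrow> continuous_map (order_top K) euclideanreal (h s)"
        "\<And>s x. \<lbrakk>s \<in> S; x \<in> K\<rbrakk> \<Longrightarrow> 0 \<le> h s x \<and> h s x \<le> g s x"
        "\<And>s x. \<lbrakk>s \<in> S; x \<in> K; x \<le> s\<rbrakk> \<Longrightarrow> h s x = 1"
        "\<And>s. s \<in> S \<Longrightarrow> \<bar>pairing (M i) (N i) (h s) - F i s\<bar> < e"
        using h' by simp_all
      define d where "d s = (\<lambda>x. g s x + (-1) * h s x)" for s
      have dc: "continuous_map (order_top K) euclideanreal (d s)" if "s \<in> S" for s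
        unfolding d_def using g(1) h(1) that by (intro continuous_intros) auto
      have pd: "pairing (M i) (N i) (d s) = pairing (M i) (N i) (g s) - pairing (M i) (N i) (h s)" if "s \<in> S" for s
        unfolding d_def using pairing_lincomb[OF i(1) g(1)[OF that] h(1)[OF that], of "-1"] by simp
      \<comment> \<open>With these signs the integral of the combined function is the sum of the
        absolute values of the single integrals.\<close>
      define c where "c s = sgn (pairing (M i) (N i) (d s))" for s
      let ?f = "\<lambda>x. \<Sum>s\<in>S. c s * d s x"
      text \<open>The functions \<open>d s\<close> have disjoint supports, located in the gaps of \<open>S\<close>.\<close>
      have "\<bar>?f x\<bar> \<le> 1" if x: "x \<in> K" for x
      proof (cases "\<exists>s\<in>S. d s x \<noteq> 0")
        case False
        then have "?f x = 0" by (intro sum.neutral) auto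
        then show ?thesis by simp
      next
        case True
        then obtain s where s: "s \<in> S" "d s x \<noteq> 0" by auto
        have supp: "s < x \<and> (\<forall>s'\<in>S. s < s' \<longrightarrow> x < s')" if "s \<in> S" "d s x \<noteq> 0" for s
        proof -
          have "\<not> x \<le> s" using g(3)[of s x] h(3)[of s x] that x by (auto simp: d_def)
          moreover have "\<not> s' \<le> x" if "s' \<in> S" "s < s'" for s'
            using g(4)[of s x s'] h(2)[of s x] that \<open>s \<in> S\<close> \<open>d s x \<noteq> 0\<close> x by (auto simp: d_def)
          ultimately show ?thesis by (auto simp: not_le)
        qed
        have "d s' x = 0" if "s' \<in> S" "s' \<noteq> s" for s'
        proof (rule ccontr)
          assume "d s' x \<noteq> 0"
          then show False using supp[OF s] supp[of s'] that s(1) by (metis neq_iff less_asym)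
        qed
        then have "?f x = (\<Sum>s'\<in>S. if s' = s then c s * d s x else 0)" by (intro sum.cong) auto
        also have "\<dots> = c s * d s x" using S(1) s(1) by simp
        finally have "\<bar>?f x\<bar> = \<bar>c s\<bar> * \<bar>d s x\<bar>" by (simp add: abs_mult)
        also have "\<dots> \<le> 1 * 1"
        proof (rule mult_mono)
          show "\<bar>c s\<bar> \<le> 1" by (simp add: c_def sgn_if)
          show "\<bar>d s x\<bar> \<le> 1" using g(2)[OF s(1) x] h(2)[OF s(1) x] by (simp add: d_def)
        qed auto
        finally show ?thesis by simp
      qed
      moreover have "continuous_map (order_top K) euclideanreal ?f"
        using dc S(1) by (intro continuous_intros) auto
      ultimately have "\<bar>pairing (M i) (N i) ?f\<bar> \<le> C" using C[OF i(1)] by blast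
      then have "\<bar>\<Sum>s\<in>S. c s * pairing (M i) (N i) (d s)\<bar> \<le> C"
        using pairing_sum[OF i(1) S(1) dc] by simp
      moreover have "c s * pairing (M i) (N i) (d s) = \<bar>pairing (M i) (N i) (d s)\<bar>" for s
        by (simp add: c_def abs_sgn mult.commute)
      ultimately have sumd: "(\<Sum>s\<in>S. \<bar>pairing (M i) (N i) (d s)\<bar>) \<le> C" by simp
      have "\<bar>F i s\<bar> \<le> \<bar>pairing (M i) (N i) (d s)\<bar> + 2 * e" if "s \<in> S" for s
        using pd[OF that] h(4)[OF that] i(2)[OF that] by linarith
      then have "(\<Sum>s\<in>S. \<bar>F i s\<bar>) \<le> (\<Sum>s\<in>S. \<bar>pairing (M i) (N i) (d s)\<bar> + 2 * e)" by (rule sum_mono)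
      also have "\<dots> = (\<Sum>s\<in>S. \<bar>pairing (M i) (N i) (d s)\<bar>) + 2 * (real (card S) * e)"
        by (simp add: sum.distrib)
      also have "\<dots> \<le> C + 2" using sumd e(2) by linarith
      finally show ?thesis .
    qed
    \<comment> \<open>The exceptional indices are read off from the bumps \<open>g s\<close> alone;
      the bumps \<open>h s\<close> were chosen after \<open>i\<close>.\<close>
    then have "{i\<in>I. \<not> (\<Sum>s\<in>S. \<bar>F i s\<bar>) \<le> C + 2} \<subseteq> (\<Union>s\<in>S. {i\<in>I. \<bar>pairing (M i) (N i) (g s)\<bar> \<ge> e})"
      by (force simp: not_le)
    then show ?thesis using fin finite_subset by blast
  qed
  then show ?thesis by blast
qed

end

section \<open>Countable exceptional sets\<close>

lemma countable_rtrancl_Image: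
  assumes "\<And>x. countable (R `` {x})"
  shows "countable (R\<^sup>* `` {x})"
proof -
  have n: "countable ((R ^^ n) `` {x})" for n
  proof (induction n)
    case (Suc n)
    have "(R ^^ Suc n) `` {x} = (\<Union>y\<in>(R ^^ n) `` {x}. R `` {y})" by auto
    then show ?case using Suc assms by simp
  qed simp
  have "R\<^sup>* `` {x} = (\<Union>n. (R ^^ n) `` {x})" by (auto simp: rtrancl_is_UN_relpow)
  then show ?thesis using n by simp
qed

context null_family
begin

text \<open>Joining two points whenever they lie in a common \<open>P i\<close> gives a graph with countable
  connected components, and each \<open>P i\<close> lies in one component. Enumerating every component, one
  keeps a point \<open>s\<close> of \<open>P i\<close> as long as \<open>\<bar>F i\<bar>\<close> summed over the points enumerated up to \<open>s\<close>
  satisfies the bound that holds for all but finitely many \<open>i\<close>.\<close>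

lemma type_c0l1_if_countable_exceptions:
  assumes Q: "Q \<subseteq> K"
    and P: "\<And>i. i \<in> I \<Longrightarrow> countable (P i)"
    and c0: "\<And>s. s \<in> Q \<Longrightarrow> c0_lim I (\<lambda>i. if s \<in> P i then 0 else F i s)"
  shows "type_c0l1 I F Q"
proof -
  obtain C where C: "\<And>S. \<lbrakk>finite S; S \<subseteq> K\<rbrakk> \<Longrightarrow> finite {i\<in>I. \<not> (\<Sum>s\<in>S. \<bar>F i s\<bar>) \<le> C}"
    using ex_cofinite_sum_bound by blast
  \<comment> \<open>Discarding the zeros leaves only the countably many indices with
    \<open>F i s \<noteq> 0\<close> able to join \<open>s\<close> to other points.\<close>
  define P' where "P' i = {s\<in>P i \<inter> Q. F i s \<noteq> 0}" for i
  define R where "R = {(s, s'). \<exists>i\<in>I. s \<in> P' i \<and> s' \<in> P' i}"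
  have "countable (R `` {s})" for s
  proof (cases "s \<in> Q")
    case True
    have "R `` {s} \<subseteq> (\<Union>i\<in>{i\<in>I. F i s \<noteq> 0}. P i)" by (auto simp: R_def P'_def)
    moreover have "countable (\<Union>i\<in>{i\<in>I. F i s \<noteq> 0}. P i)"
      using countable_F_nonzero True Q P by (intro countable_UN) auto
    ultimately show ?thesis by (rule countable_subset)
  next
    case False
    then have "R `` {s} = {}" by (auto simp: R_def P'_def)
    then show ?thesis by simp
  qed
  then have countable_comp: "countable (R\<^sup>* `` {s})" for s by (rule countable_rtrancl_Image)
  have "sym R" by (auto simp: R_def sym_def)
  then have comp_eq: "R\<^sup>* `` {s'} = R\<^sup>* `` {s}" if "s' \<in> R\<^sup>* `` {s}" for s s'
    using that sym_rtrancl[of R] by (auto dest: symD intro: rtrancl_trans)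
  \<comment> \<open>\<open>to_nat_on\<close> sees only the component as a set, so all its points
    share one enumeration and \<open>D s\<close> is finite. As \<open>D s\<close> does not depend on
    \<open>i\<close>, only finitely many indices break the bound over it.\<close>
  define r where "r s = to_nat_on (R\<^sup>* `` {s}) s" for s
  define D where "D s = {s'\<in>R\<^sup>* `` {s} \<inter> K. r s' \<le> r s}" for s
  have D_fin: "finite (D s)" for s
  proof -
    have "inj_on (to_nat_on (R\<^sup>* `` {s})) (R\<^sup>* `` {s})"
      using countable_comp by (rule inj_on_to_nat_on)
    then have "inj_on (to_nat_on (R\<^sup>* `` {s})) (D s)" by (rule inj_on_subset) (auto simp: D_def)
    moreover have "to_nat_on (R\<^sup>* `` {s}) ` D s \<subseteq> {..r s}"
    proof (rule image_subsetI)
      fix s' assume "s' \<in> D s"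
      then show "to_nat_on (R\<^sup>* `` {s}) s' \<in> {..r s}"
        using comp_eq[of s' s] by (auto simp: D_def r_def)
    qed
    ultimately show ?thesis by (meson finite_atMost inj_on_finite)
  qed
  define keep where "keep i s \<longleftrightarrow> s \<in> P' i \<and> (\<Sum>s'\<in>D s. \<bar>F i s'\<bar>) \<le> C" for i s
  define b where "b i s = (if keep i s then F i s else 0)" for i s
  define a where "a i s = F i s - b i s" for i s
  \<comment> \<open>A nonzero \<open>a i s\<close> has one of two causes: \<open>s\<close> lies
    outside \<open>P i\<close>, or the sum over \<open>D s\<close> exceeds \<open>C\<close>.\<close>
  have a_c0: "c0_lim I (\<lambda>i. a i s)" if s: "s \<in> Q" for s
  proof (rule c0_lim_combine[OF c0[OF s]])
    show "c0_lim I (\<lambda>i. if (\<Sum>s'\<in>D s. \<bar>F i s'\<bar>) \<le> C then 0 else F i s)"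
    proof (rule c0_lim_finite_support)
      show "finite {i\<in>I. (if (\<Sum>s'\<in>D s. \<bar>F i s'\<bar>) \<le> C then 0 else F i s) \<noteq> 0}"
        by (rule rev_finite_subset[OF C[OF D_fin[of s]]]) (auto simp: D_def)
    qed
    show "\<bar>a i s\<bar> \<le> \<bar>if s \<in> P i then 0 else F i s\<bar> \<or>
      \<bar>a i s\<bar> \<le> \<bar>if (\<Sum>s'\<in>D s. \<bar>F i s'\<bar>) \<le> C then 0 else F i s\<bar>" for i
      using s by (auto simp: a_def b_def keep_def P'_def)
  qed
  \<comment> \<open>The maximum with 0 covers the case that nothing is kept, since the sign of
    \<open>C\<close> is not known.\<close>
  have b_sum: "(\<Sum>s\<in>X. \<bar>b i s\<bar>) \<le> max C 0" if i: "i \<in> I" and X: "finite X" "X \<subseteq> Q" for i X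
  proof (cases "{s\<in>X. keep i s} = {}")
    case True
    then have "(\<Sum>s\<in>X. \<bar>b i s\<bar>) = 0" by (intro sum.neutral) (auto simp: b_def)
    then show ?thesis by simp
  next
    case False
    let ?Y = "{s\<in>X. keep i s}"
    have fY: "finite (r ` ?Y)" using X by simp
    \<comment> \<open>This is the kept point of \<open>X\<close> that is enumerated last. All kept
      points of \<open>X\<close> belong to its \<open>D s\<close>, over which the sum is at most
      \<open>C\<close>.\<close>
    obtain s where s: "s \<in> ?Y" "r s = Max (r ` ?Y)"
      using Max_in[OF fY] False by (metis (no_types, lifting) image_iff image_is_empty)
    have "?Y \<subseteq> D s"
    proof
      fix s' assume s': "s' \<in> ?Y"
      then have "(s, s') \<in> R" using s i by (auto simp: R_def keep_def)
      moreover have "r s' \<le> r s" using s(2) Max_ge[OF fY] s' by simp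
      ultimately show "s' \<in> D s" using s' X Q by (auto simp: D_def)
    qed
    have "(\<Sum>s\<in>X. \<bar>b i s\<bar>) = (\<Sum>s\<in>?Y. \<bar>F i s\<bar>)"
      by (rule sum.mono_neutral_cong_right) (use X in \<open>auto simp: b_def\<close>)
    also have "\<dots> \<le> (\<Sum>s'\<in>D s. \<bar>F i s'\<bar>)"
      by (rule sum_mono2[OF D_fin \<open>?Y \<subseteq> D s\<close>]) simp
    also have "\<dots> \<le> C" using s(1) by (simp add: keep_def)
    finally show ?thesis by simp
  qed
  have "(\<lambda>t. \<bar>b i t\<bar>) summable_on Q \<and> (\<Sum>\<^sub>\<infinity>t\<in>Q. \<bar>b i t\<bar>) \<le> max C 0" if i: "i \<in> I" for i
  proof
    show sm: "(\<lambda>t. \<bar>b i t\<bar>) summable_on Q"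
      by (rule nonneg_bdd_above_summable_on) (use b_sum[OF i] in \<open>auto simp: bdd_above_def\<close>)
    show "(\<Sum>\<^sub>\<infinity>t\<in>Q. \<bar>b i t\<bar>) \<le> max C 0"
      by (rule infsum_le_finite_sums[OF sm b_sum[OF i]])
  qed
  moreover have "\<forall>i\<in>I. \<forall>t\<in>Q. F i t = a i t + b i t" by (simp add: a_def)
  ultimately show ?thesis unfolding type_c0l1_def using a_c0 by blast
qed

end

text \<open>Take the support of \<open>b i\<close>: it is countable because \<open>b i\<close> is
  absolutely summable, and off it the value of \<open>F i\<close> is that of
  \<open>a i\<close>.\<close>

lemma type_c0l1_countable_exceptions:
  assumes "type_c0l1 I F Q"
  obtains P where "\<And>i. i \<in> I \<Longrightarrow> countable (P i)"
    "\<And>s. s \<in> Q \<Longrightarrow> c0_lim I (\<lambda>i. if s \<in> P i then 0 else F i s)"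
proof -
  obtain a b C where ab: "\<And>i t. \<lbrakk>i \<in> I; t \<in> Q\<rbrakk> \<Longrightarrow> F i t = a i t + b i t"
    "\<And>t. t \<in> Q \<Longrightarrow> c0_lim I (\<lambda>i. a i t)" "\<And>i. i \<in> I \<Longrightarrow> (\<lambda>t. \<bar>b i t\<bar>) summable_on Q"
    using assms unfolding type_c0l1_def by metis
  show ?thesis
  proof (rule that[of "\<lambda>i. {t\<in>Q. b i t \<noteq> 0}"])
    show "countable {t\<in>Q. b i t \<noteq> 0}" if "i \<in> I" for i
      using abs_summable_countable[of "b i" Q] ab(3)[OF that] by simp
    show "c0_lim I (\<lambda>i. if s \<in> {t\<in>Q. b i t \<noteq> 0} then 0 else F i s)" if "s \<in> Q" for s
      by (rule c0_lim_mono[OF ab(2)[OF that]]) (use that ab(1) in auto)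
  qed
qed

section \<open>Weak*-null families under continuous maps\<close>

context null_family
begin

lemma weak_star_null: "weak_star_null K I F"
  unfolding weak_star_null_def using assoc null by (auto simp: pairing_def)

lemma NBV: "i \<in> I \<Longrightarrow> F i \<in> NBV K"
  using assoc by (rule associated_NBV)

lemma separably_determined_exceptions:
  assumes "separably_determined TYPE('i) K" "Q \<subseteq> K"
    and "\<And>H. \<lbrakk>closedin (order_top K) H; separable_space (subtopology (order_top K) H)\<rbrakk> \<Longrightarrow>
      countable {t \<in> Q \<inter> (H - right_isolated H). \<not> c0_lim I (\<lambda>i. F i t)}"
  obtains P where "\<And>i. i \<in> I \<Longrightarrow> countable (P i)"
    "\<And>s. s \<in> Q \<Longrightarrow> c0_lim I (\<lambda>i. if s \<in> P i then 0 else F i s)"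
proof -
  have "type_c0l1 I F Q"
    using assms weak_star_null NBV unfolding separably_determined_def by blast
  then show ?thesis using that by (rule type_c0l1_countable_exceptions)
qed

lemma null_family_pushforward:
  assumes L: "compact_line L" and f: "continuous_map (order_top K) (order_top L) f"
  shows "null_family L I (\<lambda>i t. measure (M i) {x\<in>K. f x \<le> t} - measure (N i) {x\<in>K. f x \<le> t})
    (\<lambda>i. distr (M i) (order_borel L) f) (\<lambda>i. distr (N i) (order_borel L) f)"
proof
  show "c0_lim I (\<lambda>i. pairing (distr (M i) (order_borel L) f) (distr (N i) (order_borel L) f) g)"
    if g: "continuous_map (order_top L) euclideanreal g" for g
    using null[OF continuous_map_compose[OF f g]] pairing_distr[OF assoc f g]
      c0_lim_cong[of I "\<lambda>i. pairing (distr (M i) (order_borel L) f) (distr (N i) (order_borel L) f) g"]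
    by simp
qed (use L associated_pushforward[OF assoc f] in auto)

lemma c0_lim_if_uncharged:
  assumes s: "s \<in> K" "u \<in> K" "s < u"
    and U: "\<And>i. \<lbrakk>i \<in> I; U i\<rbrakk> \<Longrightarrow> measure (M i) {x\<in>K. s < x \<and> x < u} = 0 \<and> measure (N i) {x\<in>K. s < x \<and> x < u} = 0"
  shows "c0_lim I (\<lambda>i. if U i then F i s else 0)"
proof -
  obtain g where g: "continuous_map (order_top K) euclideanreal g" "\<And>x. x \<in> K \<Longrightarrow> 0 \<le> g x \<and> g x \<le> 1"
    "\<And>x. \<lbrakk>x \<in> K; x \<le> s\<rbrakk> \<Longrightarrow> g x = 1" "\<And>x. \<lbrakk>x \<in> K; u \<le> x\<rbrakk> \<Longrightarrow> g x = 0"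
    using order_top_Urysohn[OF K s] by blast
  show ?thesis
  proof (rule c0_lim_mono[OF null[OF g(1)]])
    fix i assume i: "i \<in> I"
    show "\<bar>if U i then F i s else 0\<bar> \<le> \<bar>pairing (M i) (N i) g\<bar>"
      using pairing_gap[OF assoc[OF i] s(1,2) g] U[OF i] by auto
  qed
qed

end

section \<open>Fibres of monotone surjections\<close>

text \<open>The fibre is compact as the preimage of a closed point, so it has a minimum and a
  maximum; monotonicity fills in everything between them.\<close>

lemma monotone_fibre_interval:
  fixes \<phi> :: "'a::linorder \<Rightarrow> 'b::linorder"
  assumes K: "compact_line K" and cont: "continuous_map (order_top K) (order_top L) \<phi>"
    and mono: "\<forall>x\<in>K. \<forall>y\<in>K. x \<le> y \<longrightarrow> \<phi> x \<le> \<phi> y" and t: "t \<in> \<phi> ` K"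
  shows "\<exists>a b. a \<in> K \<and> b \<in> K \<and> a \<le> b \<and> \<phi> a = t \<and> \<phi> b = t \<and> {x\<in>K. \<phi> x = t} = {x\<in>K. a \<le> x \<and> x \<le> b}"
proof -
  let ?J = "{x\<in>K. \<phi> x = t}"
  have "t \<in> L" using t continuous_map_image_subset_topspace[OF cont] by auto
  then have "closedin (order_top L) {t}" by (simp add: closedin_Hausdorff_singleton Hausdorff_order_top)
  then have "closedin (order_top K) {x \<in> topspace (order_top K). \<phi> x \<in> {t}}"
    by (rule closedin_continuous_map_preimage[OF cont])
  then have "closedin (order_top K) ?J" by simp
  then have J: "compactin (order_top K) ?J"
    using closedin_compact_space compact_space_order_top[OF K] by blast
  have ne: "?J \<noteq> {}" using t by auto
  obtain a where a: "a \<in> ?J" "\<And>x. x \<in> ?J \<Longrightarrow> a \<le> x" using compactin_order_top_has_min[OF J ne] by blast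
  obtain b where b: "b \<in> ?J" "\<And>x. x \<in> ?J \<Longrightarrow> x \<le> b" using compactin_order_top_has_max[OF J ne] by blast
  have "\<phi> x = t" if x: "x \<in> K" "a \<le> x" "x \<le> b" for x
  proof (rule antisym)
    show "\<phi> x \<le> t" using mono x a(1) b(1) by fastforce
    show "t \<le> \<phi> x" using mono x a(1) b(1) by fastforce
  qed
  then have "?J = {x\<in>K. a \<le> x \<and> x \<le> b}" using a(2) b(2) by auto
  then show ?thesis using a b by blast
qed

text \<open>A point of \<open>H\<close> that is not right-isolated is a limit from the right of any dense subset
  of \<open>H\<close>, and the maxima of the corresponding fibres then converge to the maximum of its fibre.\<close>

lemma separable_lift_fibre_max:
  fixes K :: "'a::linorder set" and L :: "'b::linorder set"
  assumes L: "compact_line L"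
    and mono: "\<forall>x\<in>K. \<forall>y\<in>K. x \<le> y \<longrightarrow> \<phi> x \<le> \<phi> y" and \<phi>L: "\<phi> ` K = L"
    and \<beta>: "\<And>t. t \<in> L \<Longrightarrow> \<beta> t \<in> K" "\<And>t. t \<in> L \<Longrightarrow> \<phi> (\<beta> t) = t"
      "\<And>t x. \<lbrakk>t \<in> L; x \<in> K; \<phi> x = t\<rbrakk> \<Longrightarrow> x \<le> \<beta> t"
    and H: "closedin (order_top L) H" and sep: "separable_space (subtopology (order_top L) H)"
  obtains H' where "closedin (order_top K) H'" "separable_space (subtopology (order_top K) H')"
    "\<beta> ` (H - right_isolated H) \<subseteq> H' - right_isolated H'"
proof -
  have HL: "H \<subseteq> L" using closedin_subset[OF H] by simp
  then have topH: "topspace (subtopology (order_top L) H) = H" by auto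
  obtain D where D: "countable D" "D \<subseteq> H" "subtopology (order_top L) H closure_of D = H"
    using sep unfolding separable_space_def topH by blast
  have DL: "D \<subseteq> L" using D(2) HL by auto
  \<comment> \<open>Closing the lift of the dense set, rather than the lift of all of
    \<open>H\<close>, keeps \<open>H'\<close> separable.\<close>
  define H' where "H' = order_top K closure_of (\<beta> ` D)"
  have \<beta>D: "\<beta> ` D \<subseteq> K" using \<beta>(1) DL by auto
  then have \<beta>DH': "\<beta> ` D \<subseteq> H'" unfolding H'_def by (intro closure_of_subset) simp
  have H'K: "H' \<subseteq> K" unfolding H'_def using closure_of_subset_topspace by fastforce
  have \<beta>_less: "\<beta> t < \<beta> d" if "t \<in> L" "d \<in> L" "t < d" for t d
  proof (rule ccontr)
    assume "\<not> \<beta> t < \<beta> d"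
    then have "\<phi> (\<beta> d) \<le> \<phi> (\<beta> t)" using mono \<beta>(1) that by (simp add: not_less)
    then show False using \<beta>(2) that by simp
  qed
  \<comment> \<open>Points of \<open>D\<close> lift to points arbitrarily close to
    \<open>\<beta> t\<close> on its right. This yields both membership in the closure and the
    failure of right isolation.\<close>
  have key: "\<exists>d\<in>D. \<beta> t < \<beta> d \<and> \<beta> d < u"
    if t: "t \<in> H - right_isolated H" and u: "u \<in> K" "\<beta> t < u" for t u
  proof -
    have tL: "t \<in> L" using t HL by auto
    have \<phi>u: "\<phi> u \<in> L" using u \<phi>L by auto
    have "\<phi> (\<beta> t) \<le> \<phi> u" using mono \<beta>(1)[OF tL] u by auto
    moreover have "\<phi> u \<noteq> t" using \<beta>(3)[OF tL u(1)] u(2) by auto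
    ultimately have tu: "t < \<phi> u" using \<beta>(2)[OF tL] by simp
    obtain y where y: "y \<in> H" "t < y" using t by (auto simp: right_isolated_def not_le)
    have dense: "\<exists>z\<in>H. t < z \<and> z < y" if "y \<in> H" "t < y" for y
      using t that by (auto simp: right_isolated_def)
    let ?W = "{y\<in>H. t < y \<and> y < \<phi> u}"
    \<comment> \<open>Otherwise the part of \<open>H\<close> above \<open>t\<close> would be the
      compact set \<open>?E\<close>, whose least element would be an immediate successor of
      \<open>t\<close> in \<open>H\<close>.\<close>
    have "?W \<noteq> {}"
    proof
      assume W: "?W = {}"
      let ?E = "H \<inter> {z\<in>L. \<phi> u \<le> z}"
      have "closedin (order_top L) ?E" using H closedin_order_top_atLeast[OF \<phi>u] by (rule closedin_Int)
      then have E: "compactin (order_top L) ?E"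
        using closedin_compact_space compact_space_order_top[OF L] by blast
      have upper: "z \<in> ?E" if "z \<in> H" "t < z" for z using W that HL by force
      then have "?E \<noteq> {}" using y by blast
      then obtain m where m: "m \<in> ?E" "\<And>z. z \<in> ?E \<Longrightarrow> m \<le> z"
        using compactin_order_top_has_min[OF E] by blast
      have "m \<in> H" "t < m" using m(1) tu by auto
      then obtain z where z: "z \<in> H" "t < z" "z < m" using dense by blast
      have "m \<le> z" using m(2) upper z(1,2) by blast
      then show False using z(3) by simp
    qed
    then obtain w where w: "w \<in> ?W" by auto
    have "?W = H \<inter> ({z\<in>L. t < z} \<inter> {z\<in>L. z < \<phi> u})" using HL by auto
    moreover have "openin (order_top L) ({z\<in>L. t < z} \<inter> {z\<in>L. z < \<phi> u})"
      by (intro openin_Int openin_order_top_greater openin_order_top_less tL \<phi>u)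
    ultimately have W: "openin (subtopology (order_top L) H) ?W"
      using openin_subtopology_Int2[of "order_top L" _ H] by simp
    have "w \<in> subtopology (order_top L) H closure_of D" using w D(3) by auto
    then have "w \<in> T \<and> openin (subtopology (order_top L) H) T \<Longrightarrow> \<exists>y. y \<in> D \<and> y \<in> T" for T
      unfolding in_closure_of by blast
    from this[OF conjI[OF w W]] obtain d where d: "d \<in> D" "d \<in> ?W" by blast
    have "d \<in> L" using d DL by auto
    have "\<beta> d < u"
    proof (rule ccontr)
      assume "\<not> \<beta> d < u"
      then have "\<phi> u \<le> \<phi> (\<beta> d)" using mono \<beta>(1)[OF \<open>d \<in> L\<close>] u by (simp add: not_less)
      then show False using \<beta>(2)[OF \<open>d \<in> L\<close>] d(2) by auto
    qed
    then show ?thesis using \<beta>_less[OF tL \<open>d \<in> L\<close>] d by auto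
  qed
  show ?thesis
  proof (rule that)
    show "closedin (order_top K) H'" by (simp add: H'_def)
    have topH': "topspace (subtopology (order_top K) H') = H'" using H'K by auto
    have "subtopology (order_top K) H' closure_of (\<beta> ` D) = H'"
      using \<beta>DH' by (simp add: closure_of_subtopology H'_def Int_absorb1)
    then show "separable_space (subtopology (order_top K) H')"
      unfolding separable_space_def topH' using D(1) \<beta>DH' by (intro exI[of _ "\<beta> ` D"]) auto
    show "\<beta> ` (H - right_isolated H) \<subseteq> H' - right_isolated H'"
    proof (rule image_subsetI)
      fix t assume t: "t \<in> H - right_isolated H"
      then have tL: "t \<in> L" using HL by auto
      obtain y where y: "y \<in> H" "t < y" using t by (auto simp: right_isolated_def not_le)
      then have yL: "y \<in> L" using HL by auto
      have "\<beta> t \<in> H'"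
        unfolding H'_def in_closure_of
      proof (intro conjI allI impI)
        fix U assume "\<beta> t \<in> U \<and> openin (order_top K) U"
        then obtain u where u: "u \<in> K" "\<beta> t < u" "{z\<in>K. \<beta> t \<le> z \<and> z < u} \<subseteq> U"
          using openin_order_top_right_interval[of K U "\<beta> t" "\<beta> y"] \<beta>(1)[OF yL] \<beta>_less[OF tL yL y(2)] by blast
        obtain d where d: "d \<in> D" "\<beta> t < \<beta> d" "\<beta> d < u" using key[OF t u(1,2)] by auto
        then have "\<beta> d \<in> {z\<in>K. \<beta> t \<le> z \<and> z < u}" using \<beta>D by auto
        then show "\<exists>z. z \<in> \<beta> ` D \<and> z \<in> U" using u(3) d(1) by (intro exI[of _ "\<beta> d"]) blast
      qed (use \<beta>(1)[OF tL] in simp)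
      moreover have "\<beta> t \<notin> right_isolated H'"
      proof
        assume "\<beta> t \<in> right_isolated H'"
        then consider "\<forall>z\<in>H'. z \<le> \<beta> t"
          | v where "v \<in> H'" "\<beta> t < v" "\<not> (\<exists>z\<in>H'. \<beta> t < z \<and> z < v)"
          by (auto simp: right_isolated_def)
        then show False
        proof cases
          case 1
          obtain d where "d \<in> D" "\<beta> t < \<beta> d"
            using key[OF t \<beta>(1)[OF yL] \<beta>_less[OF tL yL y(2)]] by auto
          then show False using 1 \<beta>DH' by (meson image_subset_iff leD)
        next
          case 2
          then obtain d where "d \<in> D" "\<beta> t < \<beta> d" "\<beta> d < v" using key[OF t, of v] H'K by blast
          then show False using 2(3) \<beta>DH' by blast
        qed
      qed
      ultimately show "\<beta> t \<in> H' - right_isolated H'" by simp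
    qed
  qed
qed

context null_family
begin

text \<open>Clamping preserves the values below \<open>b\<close> but moves all mass above
  \<open>b\<close> onto \<open>b\<close>, so the value at \<open>b\<close> becomes the total mass,
  which tends to 0. Hence \<open>b\<close> is never a bad point of the push-forward and the
  hypothesis on \<open>Q\<close> transfers to the interval. About \<open>F i b\<close> itself the
  clamped family says nothing, which is why the conclusion stops below \<open>b\<close>.\<close>

lemma fibre_exceptions:
  assumes ab: "a \<in> K" "b \<in> K" "a \<le> b"
    and sd: "separably_determined TYPE('i) {x\<in>K. a \<le> x \<and> x \<le> b}"
    and Q: "\<And>H. \<lbrakk>closedin (order_top K) H; separable_space (subtopology (order_top K) H)\<rbrakk> \<Longrightarrow>
      countable {t \<in> Q \<inter> (H - right_isolated H). \<not> c0_lim I (\<lambda>i. F i t)}"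
  shows "\<exists>P. (\<forall>i\<in>I. countable (P i)) \<and>
    (\<forall>s\<in>Q \<inter> K. a \<le> s \<and> s < b \<longrightarrow> c0_lim I (\<lambda>i. if s \<in> P i then 0 else F i s))"
proof -
  let ?J = "{x\<in>K. a \<le> x \<and> x \<le> b}" and ?\<rho> = "\<lambda>x. max a (min x b)"
  define G where "G i t = measure (M i) {x\<in>K. ?\<rho> x \<le> t} - measure (N i) {x\<in>K. ?\<rho> x \<le> t}" for i t
  interpret J: null_family ?J I G "\<lambda>i. distr (M i) (order_borel ?J) ?\<rho>" "\<lambda>i. distr (N i) (order_borel ?J) ?\<rho>"
    unfolding G_def
    by (rule null_family_pushforward[OF compact_line_atLeastAtMost[OF K ab] continuous_map_clamp[OF ab]])
  have G_eq: "G i s = F i s" if "i \<in> I" "s \<in> ?J" "s < b" for i s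
  proof -
    have "{x\<in>K. ?\<rho> x \<le> s} = {x\<in>K. x \<le> s}" using that by (auto simp: min_le_iff_disj)
    then show ?thesis using F_eq that by (simp add: G_def)
  qed
  have G_top: "c0_lim I (\<lambda>i. G i b)"
  proof (rule c0_lim_mono[OF null[of "\<lambda>x. 1"]])
    fix i assume i: "i \<in> I"
    have "{x\<in>K. ?\<rho> x \<le> b} = K" using ab by auto
    then show "\<bar>G i b\<bar> \<le> \<bar>pairing (M i) (N i) (\<lambda>x. 1)\<bar>"
      using radon_on_space[OF radon(1)[OF i]] radon_on_space[OF radon(2)[OF i]]
      by (simp add: G_def pairing_def)
  qed simp
  have top: "order_top ?J = subtopology (order_top K) ?J" by (rule order_top_atLeastAtMost[OF ab])
  have clJ: "closedin (order_top K) ?J"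
  proof -
    have "?J = {x\<in>K. a \<le> x} \<inter> {x\<in>K. x \<le> b}" by auto
    then show ?thesis
      using closedin_Int[OF closedin_order_top_atLeast[OF ab(1)] closedin_order_top_atMost[OF ab(2)]]
      by (simp only:)
  qed
  obtain P where P: "\<And>i. i \<in> I \<Longrightarrow> countable (P i)"
    "\<And>s. s \<in> Q \<inter> ?J \<Longrightarrow> c0_lim I (\<lambda>i. if s \<in> P i then 0 else G i s)"
  proof (rule J.separably_determined_exceptions[OF sd, of "Q \<inter> ?J"])
    fix H assume H: "closedin (order_top ?J) H" "separable_space (subtopology (order_top ?J) H)"
    have HJ: "H \<subseteq> ?J" using closedin_subset[OF H(1)] by simp
    have "closedin (order_top K) H" using H(1) clJ unfolding top by (rule closedin_trans_full)
    moreover have "separable_space (subtopology (order_top K) H)"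
      using H(2) HJ unfolding top by (simp add: subtopology_subtopology Int_absorb1)
    ultimately have "countable {t \<in> Q \<inter> (H - right_isolated H). \<not> c0_lim I (\<lambda>i. F i t)}" by (rule Q)
    moreover have "{t \<in> Q \<inter> ?J \<inter> (H - right_isolated H). \<not> c0_lim I (\<lambda>i. G i t)}
      \<subseteq> {t \<in> Q \<inter> (H - right_isolated H). \<not> c0_lim I (\<lambda>i. F i t)}"
    proof
      fix t assume t: "t \<in> {t \<in> Q \<inter> ?J \<inter> (H - right_isolated H). \<not> c0_lim I (\<lambda>i. G i t)}"
      then have "t \<noteq> b" using G_top by auto
      then have "t < b" using t by auto
      then have "c0_lim I (\<lambda>i. G i t) \<longleftrightarrow> c0_lim I (\<lambda>i. F i t)"
        using G_eq t by (intro c0_lim_cong) auto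
      then show "t \<in> {t \<in> Q \<inter> (H - right_isolated H). \<not> c0_lim I (\<lambda>i. F i t)}" using t by auto
    qed
    ultimately show "countable {t \<in> Q \<inter> ?J \<inter> (H - right_isolated H). \<not> c0_lim I (\<lambda>i. G i t)}"
      by (rule countable_subset[rotated])
  qed auto
  have "c0_lim I (\<lambda>i. if s \<in> P i then 0 else F i s)" if "s \<in> Q \<inter> K" "a \<le> s" "s < b" for s
  proof (rule c0_lim_mono[OF P(2)[of s]])
    show "s \<in> Q \<inter> ?J" using that by auto
    show "\<bar>if s \<in> P i then 0 else F i s\<bar> \<le> \<bar>if s \<in> P i then 0 else G i s\<bar>" if "i \<in> I" for i
      using G_eq[OF that, of s] \<open>s \<in> Q \<inter> K\<close> \<open>a \<le> s\<close> \<open>s < b\<close> by auto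
  qed
  then show ?thesis using P(1) by (intro exI[of _ P]) auto
qed

end

section \<open>From the base and the fibres to the whole line\<close>

theorem theorem3p10:
  fixes K :: "'a::linorder set" and L :: "'b::linorder set" and \<phi> :: "'a \<Rightarrow> 'b"
  assumes "compact_line K" and "compact_line L"
    and "continuous_map (order_top K) (order_top L) \<phi>"
    and "\<forall>x\<in>K. \<forall>y\<in>K. x \<le> y \<longrightarrow> \<phi> x \<le> \<phi> y"
    and "\<phi> ` K = L"
    and "separably_determined TYPE('i) L"
    and "\<forall>t\<in>L. separably_determined TYPE('i) {x\<in>K. \<phi> x = t}"
  shows "separably_determined TYPE('i) K"
  unfolding separably_determined_def
proof (intro allI impI, elim conjE)
  fix I :: "'i set" and F Q
  assume wsn: "weak_star_null K I F" and Q: "Q \<subseteq> K"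
    and bad: "\<forall>H. closedin (order_top K) H \<and> separable_space (subtopology (order_top K) H) \<longrightarrow>
      countable {t \<in> Q \<inter> (H - right_isolated H). \<not> c0_lim I (\<lambda>i. F i t)}"
  obtain M N where MN: "\<forall>i\<in>I. associated K (F i) (M i) (N i)"
    "\<forall>f. continuous_map (order_top K) euclideanreal f \<longrightarrow>
       c0_lim I (\<lambda>i. integral\<^sup>L (M i) f - integral\<^sup>L (N i) f)"
    using wsn unfolding weak_star_null_def by blast
  interpret null_family K I F M N
    by unfold_locales (use assms(1) MN in \<open>auto simp: pairing_def\<close>)
  have bad: "countable {t \<in> Q \<inter> (H - right_isolated H). \<not> c0_lim I (\<lambda>i. F i t)}"
    if "closedin (order_top K) H" "separable_space (subtopology (order_top K) H)" for H
    using bad that by blast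
  have "\<forall>t\<in>L. \<exists>ab. fst ab \<in> K \<and> snd ab \<in> K \<and> fst ab \<le> snd ab \<and> \<phi> (fst ab) = t \<and> \<phi> (snd ab) = t \<and>
      {x\<in>K. \<phi> x = t} = {x\<in>K. fst ab \<le> x \<and> x \<le> snd ab}"
    using monotone_fibre_interval[OF assms(1,3,4)] assms(5) by auto
  from bchoice[OF this] obtain ab where ab: "\<forall>t\<in>L. fst (ab t) \<in> K \<and> snd (ab t) \<in> K \<and> fst (ab t) \<le> snd (ab t) \<and>
      \<phi> (fst (ab t)) = t \<and> \<phi> (snd (ab t)) = t \<and>
      {x\<in>K. \<phi> x = t} = {x\<in>K. fst (ab t) \<le> x \<and> x \<le> snd (ab t)}" ..
  define \<alpha> \<beta> where "\<alpha> t = fst (ab t)" and "\<beta> t = snd (ab t)" for t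
  have \<alpha>: "\<alpha> t \<in> K" "\<alpha> t \<le> \<beta> t" and \<beta>: "\<beta> t \<in> K" "\<phi> (\<beta> t) = t"
    and fibre: "{x\<in>K. \<phi> x = t} = {x\<in>K. \<alpha> t \<le> x \<and> x \<le> \<beta> t}" if "t \<in> L" for t
    using ab that by (simp_all add: \<alpha>_def \<beta>_def)
  have le_\<beta>: "x \<le> \<beta> t" if "t \<in> L" "x \<in> K" "\<phi> x = t" for t x using fibre[OF that(1)] that by blast
  have \<phi>K: "\<phi> x \<in> L" if "x \<in> K" for x using that assms(5) by auto

  define G where "G i t = measure (M i) {x\<in>K. \<phi> x \<le> t} - measure (N i) {x\<in>K. \<phi> x \<le> t}" for i t
  interpret L: null_family L I G "\<lambda>i. distr (M i) (order_borel L) \<phi>" "\<lambda>i. distr (N i) (order_borel L) \<phi>"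
    unfolding G_def by (rule null_family_pushforward[OF assms(2,3)])
  \<comment> \<open>By monotonicity the preimage of the initial segment ending at \<open>t\<close>
    is the initial segment ending at \<open>\<beta> t\<close>.\<close>
  have G_eq: "G i t = F i (\<beta> t)" if "i \<in> I" "t \<in> L" for i t
  proof -
    have "x \<le> \<beta> t" if "x \<in> K" "\<phi> x \<le> t" for x
    proof (rule ccontr)
      assume "\<not> x \<le> \<beta> t"
      then have "\<phi> (\<beta> t) \<le> \<phi> x" using assms(4) \<beta>(1)[OF \<open>t \<in> L\<close>] that by simp
      then have "\<phi> x = t" using \<beta>(2)[OF \<open>t \<in> L\<close>] that by simp
      then show False using le_\<beta>[OF \<open>t \<in> L\<close> that(1)] \<open>\<not> x \<le> \<beta> t\<close> by simp
    qed
    moreover have "\<phi> x \<le> t" if "x \<in> K" "x \<le> \<beta> t" for x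
      using assms(4) that \<beta>[OF \<open>t \<in> L\<close>] by metis
    ultimately have "{x\<in>K. \<phi> x \<le> t} = {x\<in>K. x \<le> \<beta> t}" by blast
    then show ?thesis using F_eq[OF that(1) \<beta>(1)[OF that(2)]] by (simp add: G_def)
  qed
  obtain PL where PL: "\<And>i. i \<in> I \<Longrightarrow> countable (PL i)"
    "\<And>t. t \<in> {t\<in>L. \<beta> t \<in> Q} \<Longrightarrow> c0_lim I (\<lambda>i. if t \<in> PL i then 0 else G i t)"
  proof (rule L.separably_determined_exceptions[OF assms(6), of "{t\<in>L. \<beta> t \<in> Q}"])
    fix H assume H: "closedin (order_top L) H" "separable_space (subtopology (order_top L) H)"
    obtain H' where H': "closedin (order_top K) H'" "separable_space (subtopology (order_top K) H')"
      "\<beta> ` (H - right_isolated H) \<subseteq> H' - right_isolated H'"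
      using separable_lift_fibre_max[OF assms(2,4,5) \<beta> le_\<beta> H] by blast
    \<comment> \<open>The bad points of \<open>G\<close> in \<open>H\<close> are carried by
      \<open>\<beta>\<close> to bad points of \<open>F\<close> in \<open>H'\<close>; as
      \<open>\<phi>\<close> inverts \<open>\<beta>\<close>, countability comes back.\<close>
    let ?A = "{t \<in> {t\<in>L. \<beta> t \<in> Q} \<inter> (H - right_isolated H). \<not> c0_lim I (\<lambda>i. G i t)}"
    have "\<beta> ` ?A \<subseteq> {t \<in> Q \<inter> (H' - right_isolated H'). \<not> c0_lim I (\<lambda>i. F i t)}"
    proof (rule image_subsetI)
      fix t assume t: "t \<in> ?A"
      then have "c0_lim I (\<lambda>i. G i t) \<longleftrightarrow> c0_lim I (\<lambda>i. F i (\<beta> t))" using G_eq by (intro c0_lim_cong) auto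
      then show "\<beta> t \<in> {t \<in> Q \<inter> (H' - right_isolated H'). \<not> c0_lim I (\<lambda>i. F i t)}"
        using t H'(3) by auto
    qed
    then have "countable (\<beta> ` ?A)" using bad[OF H'(1,2)] countable_subset by blast
    moreover have "inj_on \<beta> ?A" by (rule inj_on_inverseI[of _ \<phi>]) (use \<beta>(2) in auto)
    ultimately show "countable ?A" by (rule countable_image_inj_on)
  qed auto

  have "\<forall>t\<in>L. \<exists>P. (\<forall>i\<in>I. countable (P i)) \<and>
    (\<forall>s\<in>Q \<inter> K. \<alpha> t \<le> s \<and> s < \<beta> t \<longrightarrow> c0_lim I (\<lambda>i. if s \<in> P i then 0 else F i s))"
  proof
    fix t assume t: "t \<in> L"
    have "separably_determined TYPE('i) {x\<in>K. \<alpha> t \<le> x \<and> x \<le> \<beta> t}"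
      using assms(7) t fibre[OF t] by metis
    then show "\<exists>P. (\<forall>i\<in>I. countable (P i)) \<and>
      (\<forall>s\<in>Q \<inter> K. \<alpha> t \<le> s \<and> s < \<beta> t \<longrightarrow> c0_lim I (\<lambda>i. if s \<in> P i then 0 else F i s))"
      by (rule fibre_exceptions[OF \<alpha>(1)[OF t] \<beta>(1)[OF t] \<alpha>(2)[OF t] _ bad])
  qed
  from bchoice[OF this] obtain PF where PF: "\<forall>t\<in>L. (\<forall>i\<in>I. countable (PF t i)) \<and>
    (\<forall>s\<in>Q \<inter> K. \<alpha> t \<le> s \<and> s < \<beta> t \<longrightarrow> c0_lim I (\<lambda>i. if s \<in> PF t i then 0 else F i s))" ..

  \<comment> \<open>Both members of the pair count: the gap estimate involves the sum of their
    masses, which cancellation in the difference would not make vanish.\<close>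
  define charged where "charged i =
    {t\<in>L. measure (M i) {x\<in>K. \<phi> x = t} \<noteq> 0} \<union> {t\<in>L. measure (N i) {x\<in>K. \<phi> x = t} \<noteq> 0}" for i
  show "type_c0l1 I F Q"
  proof (rule type_c0l1_if_countable_exceptions[OF Q])
    fix i assume i: "i \<in> I"
    have "countable (charged i)"
      using countable_charged_fibres[OF radon(1)[OF i] assms(3)] countable_charged_fibres[OF radon(2)[OF i] assms(3)]
      by (simp add: charged_def)
    moreover have "countable (PF t i)" if "t \<in> charged i" for t
      using PF i that by (auto simp: charged_def)
    ultimately show "countable (\<beta> ` PL i \<union> (\<Union>t\<in>charged i. PF t i))"
      using PL(1)[OF i] by simp
  next
    fix s assume s: "s \<in> Q"
    then have sK: "s \<in> K" using Q by auto
    define t where "t = \<phi> s"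
    have t: "t \<in> L" using \<phi>K[OF sK] by (simp add: t_def)
    have s_fibre: "\<alpha> t \<le> s" "s \<le> \<beta> t" using fibre[OF t] sK t_def by blast+
    let ?F = "\<lambda>i. if s \<in> \<beta> ` PL i \<union> (\<Union>t\<in>charged i. PF t i) then 0 else F i s"
    show "c0_lim I ?F"
    proof (cases "s = \<beta> t")
      case True
      have "t \<in> {t\<in>L. \<beta> t \<in> Q}" using t s True by simp
      then show ?thesis
        by (rule c0_lim_mono[OF PL(2)]) (use True G_eq[OF _ t] in auto)
    next
      case False
      then have sb: "s < \<beta> t" using s_fibre(2) by simp
      have 1: "c0_lim I (\<lambda>i. if s \<in> PF t i then 0 else F i s)"
        using PF t s sK s_fibre(1) sb by auto
      have gap_null: "measure R {x\<in>K. s < x \<and> x < \<beta> t} = 0"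
        if R: "radon_on K R" and null: "measure R {x\<in>K. \<phi> x = t} = 0" for R
      proof -
        interpret R: finite_measure R using radon_on_finite[OF R] .
        have "{x\<in>K. \<phi> x = t} = {x\<in>K. \<alpha> t \<le> x} \<inter> {x\<in>K. x \<le> \<beta> t}" using fibre[OF t] by auto
        then have "{x\<in>K. \<phi> x = t} \<in> sets R"
          using radon_on_sets_order[OF R \<alpha>(1)[OF t]] radon_on_sets_order[OF R \<beta>(1)[OF t]] by auto
        moreover have "{x\<in>K. s < x \<and> x < \<beta> t} \<subseteq> {x\<in>K. \<phi> x = t}"
          unfolding fibre[OF t] using s_fibre(1) by auto
        ultimately have "measure R {x\<in>K. s < x \<and> x < \<beta> t} \<le> measure R {x\<in>K. \<phi> x = t}"
          by (intro R.finite_measure_mono)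
        then show ?thesis using null by (simp add: measure_le_0_iff)
      qed
      have 2: "c0_lim I (\<lambda>i. if t \<notin> charged i then F i s else 0)"
        by (rule c0_lim_if_uncharged[OF sK \<beta>(1)[OF t] sb])
          (use gap_null[OF radon(1)] gap_null[OF radon(2)] t in \<open>auto simp: charged_def\<close>)
      \<comment> \<open>If \<open>i\<close> charges the fibre of \<open>s\<close>, then
        \<open>PF t i\<close> is among the exceptions and the first family dominates; otherwise the
        second one does.\<close>
      show ?thesis by (rule c0_lim_combine[OF 1 2]) auto
    qed
  qed
qed

end
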